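(* Let $\lambda\in(0,1)$, let $d\ge2$ be an integer, let $G_N$ be a bipartite compatibility graph with $\rho(G_N)\le\rho_0<1$, and let $\boldsymbol{X}_0$ be a random variable on $\{0,1,2,\dots\}^{V_N}$ such that $\boldsymbol{X}_0\le_{st}\boldsymbol{X}(\infty)$. Let $\boldsymbol{X}^{(1)}$ and $\boldsymbol{X}^{(2)}$ be two copies of the queue length process on $G_N$, with $\boldsymbol{X}^{(1)}(0)\overset{d}{=}\boldsymbol{X}_0$ and $\boldsymbol{X}^{(2)}(0)\overset{d}{=}\boldsymbol{X}^{(2)}(\infty)$ (i.e. system 2 starts from the stationary distribution). Then there exists a joint probability space (a coupling of the two processes) such that, almost surely, $X_v^{(1)}(t)\le X_v^{(2)}(t)$ for all $v\in V_N$ and all $t\ge0$.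
   Context: Model. Fix $\lambda\in(0,1)$ and an integer $d\ge2$. $G_N=(V_N,W_N,E_N)$ is a finite bipartite graph, with $V_N$ the set of servers, $|V_N|=N$, $W_N$ the set of task types (dispatchers), $|W_N|=M(N)$, and $E_N\subseteq V_N\times W_N$. For $v\in V_N$ let $\mathcal{N}_v=\{w\in W_N:(v,w)\in E_N\}$; for $w\in W_N$ let $\mathcal{N}_w=\{v\in V_N:(v,w)\in E_N\}$, $d_w^N=|\mathcal{N}_w|$; assume $d_w^N\ge1$ for all $w$. Tasks of each type arrive according to independent Poisson processes of rate $\lambda N/M(N)$ each, and each task has an independent exponential service time of mean one. When a task of type $w$ arrives, $d$ servers are sampled uniformly at random with replacement from $\mathcal{N}_w$, and the task joins the shortest queue among the sampled servers, ties broken uniformly at random. Each server serves its queue one task at a time, first come first served. $X_v(t)\in\{0,1,2,\dots\}$ is the queue length (including any task in service) of server $v$ at time $t$; $\boldsymbol{X}(t)=(X_v(t))_{v\in V_N}$ is a continuous-time Markov chain. $$\rho(G_N)=\max_{v\in V_N}\frac{\lambda N}{M(N)}\sum_{w\in\mathcal{N}_v}\frac1{d_w^N}.$$ When $\rho(G_N)<1$, $\boldsymbol{X}$ has a unique stationary distribution, and $\boldsymbol{X}(\infty)$ denotes a random vector with that distribution. Stochastic ordering: for $n$-dimensional random vectors $\boldsymbol{X}=(X_1,\dots,X_n)$ and $\boldsymbol{Y}=(Y_1,\dots,Y_n)$, $\boldsymbol{X}\le_{st}\boldsymbol{Y}$ means there exists a common probability space on which $X_i\le Y_i$ for all $i=1,\dots,n$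 almost surely. For system $k\in\{1,2\}$, $X_v^{(k)}(t)$ is the queue length of server $v$ at time $t$. *)

theory Defs
  imports "HOL-Probability.Probability"
begin

text \<open>
  A bipartite compatibility graph is an edge set \<open>E :: ('v \<times> 'w) set\<close> over the finite types
  \<open>'v\<close> of servers (\<open>N = CARD('v)\<close>) and \<open>'w\<close> of task types (\<open>M(N) = CARD('w)\<close>).
\<close>

definition task_nbrs :: "('v \<times> 'w) set \<Rightarrow> 'v \<Rightarrow> 'w set" where
  "task_nbrs E v = {w. (v, w) \<in> E}"

definition server_nbrs :: "('v \<times> 'w) set \<Rightarrow> 'w \<Rightarrow> 'v set" where
  "server_nbrs E w = {v. (v, w) \<in> E}"

definition rho :: "real \<Rightarrow> ('v::finite \<times> 'w::finite) set \<Rightarrow> real" where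
  "rho lam E = (MAX v\<in>UNIV. lam * real CARD('v) / real CARD('w) *
      (\<Sum>w\<in>task_nbrs E v. 1 / real (card (server_nbrs E w))))"

text \<open>
  The law of the server joined by a task of type \<open>w\<close> arriving in state \<open>x\<close>.  Ties are broken
  uniformly over the distinct sampled servers of minimal queue length; by exchangeability, counting
  repeatedly sampled servers with multiplicity would give the same law.
\<close>

definition joined_server ::
    "('v::finite \<times> 'w::finite) set \<Rightarrow> nat \<Rightarrow> 'w \<Rightarrow> ('v \<Rightarrow> nat) \<Rightarrow> 'v pmf" where
  "joined_server E d w x = do {
     s \<leftarrow> replicate_pmf d (pmf_of_set (server_nbrs E w));
     pmf_of_set {v \<in> set s. \<forall>u\<in>set s. x v \<le> x u}
   }"

text \<open>
  A transition from \<open>x\<close> to \<open>x'\<close> at rate \<open>r\<close> contributes \<open>r\<close> to the entry \<open>(x, x')\<close> and \<open>- r\<close> to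
  the diagonal entry \<open>(x, x)\<close>, so \<open>queue_rate\<close> is a conservative (and bounded) rate matrix.
  Arrivals occur at rate \<open>lam * N / M(N)\<close> for every task type; every nonempty queue loses the task
  in service at rate one, the service times being exponential with mean one.
\<close>

definition queue_rate ::
    "real \<Rightarrow> nat \<Rightarrow> ('v::finite \<times> 'w::finite) set \<Rightarrow> ('v \<Rightarrow> nat) \<Rightarrow> ('v \<Rightarrow> nat) \<Rightarrow> real" where
  "queue_rate lam d E x y =
     (\<Sum>w\<in>UNIV. \<Sum>v\<in>UNIV. lam * real CARD('v) / real CARD('w) * pmf (joined_server E d w x) v *
        (of_bool (y = x(v := x v + 1)) - of_bool (y = x)))
   + (\<Sum>v | x v > 0. of_bool (y = x(v := x v - 1)) - of_bool (y = x))"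

text \<open>
  \<open>P t x\<close> is the law at time \<open>t\<close> of the chain started in \<open>x\<close>.  The right derivative at time \<open>0\<close>
  determines \<open>P\<close> on nonnegative times uniquely when the rates are bounded and conservative, as those
  of \<open>queue_rate\<close> are, so the existential quantifiers over \<open>P\<close> below all speak of the same \<open>P\<close>.
\<close>

definition transition_semigroup ::
    "('s \<Rightarrow> 's \<Rightarrow> real) \<Rightarrow> (real \<Rightarrow> 's \<Rightarrow> 's pmf) \<Rightarrow> bool" where
  "transition_semigroup Q P \<longleftrightarrow>
     (\<forall>x. P 0 x = return_pmf x) \<and>
     (\<forall>s\<ge>0. \<forall>t\<ge>0. \<forall>x. P (s + t) x = bind_pmf (P s x) (P t)) \<and>
     (\<forall>x y. ((\<lambda>t. pmf (P t x) y) has_real_derivative Q x y) (at_right 0))"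

text \<open>
  The discrete topology is meant on the (countable) state space, so right-continuity and existence
  of left limits say that the path is locally constant on either side of each time.
\<close>

definition cadlag_path :: "(real \<Rightarrow> 's) \<Rightarrow> bool" where
  "cadlag_path f \<longleftrightarrow>
     (\<forall>t\<ge>0. \<forall>\<^sub>F s in at_right t. f s = f t) \<and>
     (\<forall>t>0. \<exists>y. \<forall>\<^sub>F s in at_left t. f s = y)"

definition markov_chain_with_rates ::
    "('s \<Rightarrow> 's \<Rightarrow> real) \<Rightarrow> 'a measure \<Rightarrow> (real \<Rightarrow> 'a \<Rightarrow> 's) \<Rightarrow> bool" where
  "markov_chain_with_rates Q M X \<longleftrightarrow>
     prob_space M \<and>
     (\<forall>t\<ge>0. X t \<in> M \<rightarrow>\<^sub>M count_space UNIV) \<and>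
     (AE \<omega> in M. cadlag_path (\<lambda>t. X t \<omega>)) \<and>
     (\<exists>P. transition_semigroup Q P \<and>
        (\<forall>n (t :: nat \<Rightarrow> real) x. 0 \<le> t 0 \<longrightarrow> mono t \<longrightarrow>
           measure M {\<omega> \<in> space M. \<forall>i\<le>n. X (t i) \<omega> = x i} =
           measure M {\<omega> \<in> space M. X (t 0) \<omega> = x 0} *
             (\<Prod>i<n. pmf (P (t (Suc i) - t i) (x i)) (x (Suc i)))))"

definition queue_length_process ::
    "real \<Rightarrow> nat \<Rightarrow> ('v::finite \<times> 'w::finite) set \<Rightarrow> 'a measure \<Rightarrow>
     (real \<Rightarrow> 'a \<Rightarrow> 'v \<Rightarrow> nat) \<Rightarrow> bool" where
  "queue_length_process lam d E M X \<longleftrightarrow> markov_chain_with_rates (queue_rate lam d E) M X"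

definition stationary_distribution ::
    "real \<Rightarrow> nat \<Rightarrow> ('v::finite \<times> 'w::finite) set \<Rightarrow> ('v \<Rightarrow> nat) pmf \<Rightarrow> bool" where
  "stationary_distribution lam d E \<pi> \<longleftrightarrow>
     (\<exists>P. transition_semigroup (queue_rate lam d E) P \<and> (\<forall>t\<ge>0. bind_pmf \<pi> (P t) = \<pi>))"

definition random_vector :: "'a measure \<Rightarrow> ('a \<Rightarrow> 'v \<Rightarrow> nat) \<Rightarrow> bool" where
  "random_vector M X \<longleftrightarrow> prob_space M \<and> X \<in> M \<rightarrow>\<^sub>M count_space UNIV"

definition same_law ::
    "'a measure \<Rightarrow> ('a \<Rightarrow> 'v \<Rightarrow> nat) \<Rightarrow> 'b measure \<Rightarrow> ('b \<Rightarrow> 'v \<Rightarrow> nat) \<Rightarrow> bool" where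
  "same_law M X M' X' \<longleftrightarrow> distr M (count_space UNIV) X = distr M' (count_space UNIV) X'"

text \<open>
  One cannot quantify over the type of the common probability space, but pairs of states lose no
  generality: any common space can be replaced by the joint law of the two vectors on it.
\<close>

definition stoch_le ::
    "'a measure \<Rightarrow> ('a \<Rightarrow> 'v::finite \<Rightarrow> nat) \<Rightarrow> 'b measure \<Rightarrow> ('b \<Rightarrow> 'v \<Rightarrow> nat) \<Rightarrow> bool" where
  "stoch_le M1 X M2 Y \<longleftrightarrow>
     (\<exists>(M :: (('v \<Rightarrow> nat) \<times> ('v \<Rightarrow> nat)) measure) X' Y'.
        random_vector M X' \<and> random_vector M Y' \<and>
        same_law M X' M1 X \<and> same_law M Y' M2 Y \<and>
        (AE \<omega> in M. \<forall>v. X' \<omega> v \<le> Y' \<omega> v))"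

end

theory Submission imports Defs begin

text \<open>
  The coupling is graphical: both systems are driven by the same events.  Since every transition
  rate is bounded, the chain can be uniformized.  A Poisson process of rate \<open>L = (lam + 1) * N\<close>
  rings at random times, each ring carries an independent mark, and the state \<open>x\<close> is replaced by
  \<open>T m x\<close>, where \<open>m\<close> is the mark.  A mark is either a departure from a uniformly chosen server
  or an arrival, described by the set of sampled servers together with a uniformly random priority
  list of all servers.  An arriving task joins, among the sampled servers of minimal queue length, the
  one that comes first in the priority list.  As the list is uniform, this breaks ties uniformly
  (\<open>find_random_permutation\<close>), so the rates are those of \<open>queue_rate\<close>
  (\<open>queue_rate_uniformization\<close>).  The gain is that for every single mark the update is a monotone map
  (\<open>queue_step_mono\<close>).  If the task joins server \<open>a\<close> in the smaller state and another server in
  the larger state, then \<open>x a < y a\<close>, because the common list excludes the only dangerous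
  case, that of equal queues at \<open>a\<close>.  Running the two systems from ordered initial states with the same
  rings and marks therefore keeps them ordered at all times and for every outcome
  (\<open>flow_preserves\<close>).

  It remains to see that the state of this graphical construction, seen from one initial condition, is a
  Markov chain with the prescribed rates.  The rings and marks form a stream of independent pairs
  of an exponential gap and a mark.  The central fact is \<open>nn_integral_regeneration\<close>: on the event
  that exactly \<open>k\<close> rings occurred by time \<open>t\<close>, the state at \<open>t\<close> and the stream that remains to be
  read after \<open>t\<close> are independent, the remaining stream is distributed as a fresh one, and the event
  has the Poisson probability.  It is proved by induction on \<open>k\<close>, conditioning on the first ring;
  the base case is the memorylessness of the exponential distribution.  Regeneration yields at once
  the semigroup property (\<open>law_semigroup\<close>) and the product formula for the finite-dimensional
  distributions (\<open>emeasure_finite_dimensional\<close>).  The rates are read off from the power series in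
  time of the transition probabilities (\<open>law_has_derivative\<close>).

  The initial states come from the coupling provided by the stochastic order; the smaller one is
  replaced by the pointwise minimum of the two, which changes it on a null set only and makes the order
  hold everywhere.  Finally the pair of processes is transported to the space of paths.
\<close>

section \<open>Pushing a process forward to path space\<close>

text \<open>
  The target carries the largest \<open>\<sigma>\<close>-algebra that makes \<open>f\<close> measurable.  On path space, where
  events such as right-continuity or an inequality at all times are not in the product
  \<open>\<sigma>\<close>-algebra, this makes every property measurable that holds for all paths \<open>f \<omega>\<close>
  (\<open>AE_image_measure\<close>).
\<close>
definition image_measure :: "'a measure \<Rightarrow> ('a \<Rightarrow> 'b) \<Rightarrow> 'b measure" where
  "image_measure M f = distr M (sigma UNIV {A. f -` A \<inter> space M \<in> sets M}) f"

lemma sigma_algebra_vimage_measurable: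
  fixes f :: "'a \<Rightarrow> 'b"
  shows "sigma_algebra UNIV {A. f -` A \<inter> space M \<in> sets M}"
proof (unfold sigma_algebra_iff2, intro conjI ballI allI impI)
  fix A assume "A \<in> {A. f -` A \<inter> space M \<in> sets M}"
  moreover have "f -` (UNIV - A) \<inter> space M = space M - (f -` A \<inter> space M)" by auto
  ultimately show "UNIV - A \<in> {A. f -` A \<inter> space M \<in> sets M}" by auto
next
  fix A :: "nat \<Rightarrow> 'b set" assume "range A \<subseteq> {A. f -` A \<inter> space M \<in> sets M}"
  then have "(\<Union>i. f -` A i \<inter> space M) \<in> sets M" by (intro sets.countable_UN) auto
  moreover have "f -` (\<Union>i. A i) \<inter> space M = (\<Union>i. f -` A i \<inter> space M)" by auto
  ultimately show "(\<Union>i. A i) \<in> {A. f -` A \<inter> space M \<in> sets M}" by simp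
qed auto

lemma sets_image_measure: "A \<in> sets (image_measure M f) \<longleftrightarrow> f -` A \<inter> space M \<in> sets M"
  unfolding image_measure_def
  by (simp add: sigma_algebra.sets_measure_of_eq[OF sigma_algebra_vimage_measurable])

lemma space_image_measure[simp]: "space (image_measure M f) = UNIV"
  by (simp add: image_measure_def)

lemma measurable_image_measure:
  "f \<in> M \<rightarrow>\<^sub>M sigma UNIV {A. f -` A \<inter> space M \<in> sets M}"
  by (rule measurable_measure_of) auto

lemma measurable_from_image_measure:
  assumes "(\<lambda>\<omega>. g (f \<omega>)) \<in> M \<rightarrow>\<^sub>M N" "g \<in> UNIV \<rightarrow> space N"
  shows "g \<in> image_measure M f \<rightarrow>\<^sub>M N"
proof (rule measurableI)
  fix A assume "A \<in> sets N"
  then have "(\<lambda>\<omega>. g (f \<omega>)) -` A \<inter> space M \<in> sets M" using assms(1) by (rule measurable_sets[rotated])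
  then show "g -` A \<inter> space (image_measure M f) \<in> sets (image_measure M f)"
    by (simp add: sets_image_measure vimage_def)
qed (use assms in auto)

lemma emeasure_image_measure:
  assumes "A \<in> sets (image_measure M f)"
  shows "emeasure (image_measure M f) A = emeasure M (f -` A \<inter> space M)"
  using assms unfolding image_measure_def sets_distr
  by (rule emeasure_distr[OF measurable_image_measure])

lemma prob_space_image_measure: "prob_space M \<Longrightarrow> prob_space (image_measure M f)"
  unfolding image_measure_def by (intro prob_space.prob_space_distr measurable_image_measure)

lemma distr_image_measure:
  assumes "(\<lambda>\<omega>. g (f \<omega>)) \<in> M \<rightarrow>\<^sub>M N" "g \<in> UNIV \<rightarrow> space N"
  shows "distr (image_measure M f) N g = distr M N (\<lambda>\<omega>. g (f \<omega>))"
proof (rule measure_eqI)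
  have m: "g \<in> image_measure M f \<rightarrow>\<^sub>M N" by (rule measurable_from_image_measure[OF assms])
  fix A assume "A \<in> sets (distr (image_measure M f) N g)"
  then have A: "A \<in> sets N" by simp
  then have "g -` A \<in> sets (image_measure M f)" using measurable_sets[OF m A] by simp
  then show "emeasure (distr (image_measure M f) N g) A = emeasure (distr M N (\<lambda>\<omega>. g (f \<omega>))) A"
    using A by (simp add: emeasure_distr[OF m] emeasure_distr[OF assms(1)] emeasure_image_measure)
      (simp add: vimage_def)
qed simp

lemma AE_image_measure:
  assumes "\<And>\<omega>. \<omega> \<in> space M \<Longrightarrow> P (f \<omega>)"
  shows "AE p in image_measure M f. P p"
proof (rule AE_I)
  have vimage: "f -` {p. \<not> P p} \<inter> space M = {}" using assms by auto
  show "{p. \<not> P p} \<in> sets (image_measure M f)"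
    unfolding sets_image_measure vimage by simp
  then show "emeasure (image_measure M f) {p. \<not> P p} = 0"
    by (simp only: emeasure_image_measure vimage emeasure_empty)
qed simp

lemma markov_chain_image_measure:
  assumes X: "markov_chain_with_rates Q M (\<lambda>t \<omega>. Y t (f \<omega>))"
    and cadlag: "\<And>\<omega>. \<omega> \<in> space M \<Longrightarrow> cadlag_path (\<lambda>t. Y t (f \<omega>))"
  shows "markov_chain_with_rates Q (image_measure M f) Y"
proof -
  let ?N = "image_measure M f"
  have m: "Y t \<in> ?N \<rightarrow>\<^sub>M count_space UNIV" if "0 \<le> t" for t
    using X that by (intro measurable_from_image_measure) (auto simp: markov_chain_with_rates_def)
  have meas: "measure ?N {p \<in> space ?N. \<forall>i\<le>n. Y (t i) p = x i} =
      measure M {\<omega> \<in> space M. \<forall>i\<le>n. Y (t i) (f \<omega>) = x i}" if t: "0 \<le> t 0" "mono t"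
    for n :: nat and t :: "nat \<Rightarrow> real" and x
  proof -
    have "0 \<le> t i" for i using t(1) monoD[OF t(2), of 0 i] by simp
    note [measurable] = m[OF this]
    have "{p \<in> space ?N. \<forall>i\<le>n. Y (t i) p = x i} \<in> sets ?N" by measurable
    moreover have "f -` {p \<in> space ?N. \<forall>i\<le>n. Y (t i) p = x i} \<inter> space M =
        {\<omega> \<in> space M. \<forall>i\<le>n. Y (t i) (f \<omega>) = x i}"
      by auto
    ultimately show ?thesis by (simp only: measure_def emeasure_image_measure)
  qed
  from X obtain P where P: "transition_semigroup Q P" and
    fdd: "\<forall>n (t :: nat \<Rightarrow> real) x. 0 \<le> t 0 \<longrightarrow> mono t \<longrightarrow>
      measure M {\<omega> \<in> space M. \<forall>i\<le>n. Y (t i) (f \<omega>) = x i} =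
      measure M {\<omega> \<in> space M. Y (t 0) (f \<omega>) = x 0} *
        (\<Prod>i<n. pmf (P (t (Suc i) - t i) (x i)) (x (Suc i)))"
    unfolding markov_chain_with_rates_def by blast
  show ?thesis
    unfolding markov_chain_with_rates_def
  proof (intro conjI exI[of _ P] allI impI)
    show "prob_space ?N"
      using X by (intro prob_space_image_measure) (simp add: markov_chain_with_rates_def)
    show "AE p in ?N. cadlag_path (\<lambda>t. Y t p)"
      by (rule AE_image_measure) (rule cadlag)
    fix n x and t :: "nat \<Rightarrow> real" assume t: "0 \<le> t 0" "mono t"
    show "measure ?N {p \<in> space ?N. \<forall>i\<le>n. Y (t i) p = x i} =
      measure ?N {p \<in> space ?N. Y (t 0) p = x 0} *
        (\<Prod>i<n. pmf (P (t (Suc i) - t i) (x i)) (x (Suc i)))"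
      using meas[OF t, of n x] meas[OF t, of 0 x] fdd[rule_format, OF t, of n x] by simp
  qed (use m P in auto)
qed

section \<open>Epochs, states and futures of a marked sequence\<close>

text \<open>
  A chain that jumps at the points of a Poisson process of rate \<open>L\<close>, at each of them applying the
  update map \<open>T m\<close> of an independent mark \<open>m\<close> with law \<open>\<mu>\<close>.
\<close>
locale uniformized_chain =
  fixes L :: real and \<mu> :: "'m pmf" and T :: "'m \<Rightarrow> 's::countable \<Rightarrow> 's"
  assumes L_pos: "0 < L"
begin

text \<open>
  An element of a stream consists of the waiting time until the next epoch and the mark of
  that epoch.  Counting the epochs up to time \<open>t\<close> is made a relation between \<open>k\<close> and \<open>t\<close>, not a function,
  because the waiting times may have a finite sum, in which case no \<open>k\<close> fits for large \<open>t\<close>.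
\<close>
primrec jumps :: "nat \<Rightarrow> real \<Rightarrow> (real \<times> 'm) stream \<Rightarrow> bool" where
  "jumps 0 t \<omega> \<longleftrightarrow> t < fst (shd \<omega>)"
| "jumps (Suc k) t \<omega> \<longleftrightarrow> fst (shd \<omega>) \<le> t \<and> jumps k (t - fst (shd \<omega>)) (stl \<omega>)"

primrec state_after :: "nat \<Rightarrow> 's \<Rightarrow> (real \<times> 'm) stream \<Rightarrow> 's" where
  "state_after 0 x \<omega> = x"
| "state_after (Suc k) x \<omega> = state_after k (T (snd (shd \<omega>)) x) (stl \<omega>)"

text \<open>
  The stream as seen by an observer who starts the clock at time \<open>t\<close>, provided that \<open>k\<close> epochs
  have occurred: the current waiting time is shortened by the part already elapsed, the
  pending mark is kept.
\<close>
primrec future :: "nat \<Rightarrow> real \<Rightarrow> (real \<times> 'm) stream \<Rightarrow> (real \<times> 'm) stream" where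
  "future 0 t \<omega> = (fst (shd \<omega>) - t, snd (shd \<omega>)) ## stl \<omega>"
| "future (Suc k) t \<omega> = future k (t - fst (shd \<omega>)) (stl \<omega>)"

lemma jumps_unique: "jumps j t \<omega> \<Longrightarrow> jumps k t \<omega> \<Longrightarrow> j = k"
proof (induction j arbitrary: k t \<omega>)
  case 0
  then show ?case by (cases k) auto
next
  case (Suc j)
  then show ?case by (cases k) auto
qed

lemma jumps_earlier: "jumps k t \<omega> \<Longrightarrow> s \<le> t \<Longrightarrow> \<exists>j. jumps j s \<omega>"
proof (induction k arbitrary: s t \<omega>)
  case 0
  then show ?case by (intro exI[of _ 0]) auto
next
  case (Suc k)
  show ?case
  proof (cases "s < fst (shd \<omega>)")
    case True
    then show ?thesis by (intro exI[of _ 0]) auto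
  next
    case False
    obtain j where "jumps j (s - fst (shd \<omega>)) (stl \<omega>)"
      using Suc.IH[of "t - fst (shd \<omega>)" "stl \<omega>" "s - fst (shd \<omega>)"] Suc.prems by auto
    with False show ?thesis by (intro exI[of _ "Suc j"]) auto
  qed
qed

text \<open>
  Together with \<open>state_after_add\<close> this is the cocycle property: what happens after time \<open>s\<close> is the
  same construction run on the future stream.
\<close>
lemma jumps_add:
  "jumps k s \<omega> \<Longrightarrow> 0 \<le> u \<Longrightarrow> jumps m (s + u) \<omega> \<longleftrightarrow> k \<le> m \<and> jumps (m - k) u (future k s \<omega>)"
proof (induction k arbitrary: m s \<omega>)
  case 0
  then show ?case by (cases m) (auto simp: algebra_simps)
next
  case (Suc k)
  have eq: "s + u - fst (shd \<omega>) = (s - fst (shd \<omega>)) + u" by simp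
  show ?case
  proof (cases m)
    case 0
    then show ?thesis using Suc.prems by auto
  next
    case (Suc n)
    have "jumps m (s + u) \<omega> \<longleftrightarrow> jumps n ((s - fst (shd \<omega>)) + u) (stl \<omega>)"
      using Suc Suc.prems by (auto simp: eq)
    then show ?thesis using Suc Suc.IH[of "s - fst (shd \<omega>)" "stl \<omega>" n] Suc.prems by auto
  qed
qed

lemma state_after_add:
  "k \<le> m \<Longrightarrow> state_after m x \<omega> = state_after (m - k) (state_after k x \<omega>) (future k s \<omega>)"
proof (induction k arbitrary: m x s \<omega>)
  case 0
  then show ?case by (cases m) auto
next
  case (Suc k)
  then show ?case by (cases m) auto
qed

lemma jumps_eventually_at_right: "jumps k t \<omega> \<Longrightarrow> \<forall>\<^sub>F s in at_right t. jumps k s \<omega>"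
proof (induction k arbitrary: t \<omega>)
  case 0
  then show ?case by (auto simp: eventually_at_right_less intro!: order_tendstoD)
next
  case (Suc k)
  let ?a = "fst (shd \<omega>)"
  from Suc have "\<forall>\<^sub>F s in at_right (t - ?a). jumps k s (stl \<omega>)" by auto
  then have "\<forall>\<^sub>F s in at_right t. jumps k (s - ?a) (stl \<omega>)"
    unfolding filtermap_at_right_shift[symmetric] eventually_filtermap .
  moreover have "\<forall>\<^sub>F s in at_right t. t < s" by (rule eventually_at_right_less)
  ultimately show ?case by eventually_elim (use Suc.prems in auto)
qed

text \<open>
  The count \<open>j\<close> just before \<open>t\<close> may be smaller than \<open>k\<close>, since an epoch may fall on \<open>t\<close> itself; this
  is the case distinction in the induction step.
\<close>
lemma jumps_eventually_at_left: "jumps k t \<omega> \<Longrightarrow> \<exists>j. \<forall>\<^sub>F s in at_left t. jumps j s \<omega>"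
proof (induction k arbitrary: t \<omega>)
  case 0
  have "\<forall>\<^sub>F s in at_left t. s < t" by (simp add: eventually_at_filter)
  with 0 show ?case by (intro exI[of _ 0]) (auto elim!: eventually_mono)
next
  case (Suc k)
  let ?a = "fst (shd \<omega>)"
  show ?case
  proof (cases "?a = t")
    case True
    then show ?thesis by (intro exI[of _ 0]) (auto simp: eventually_at_filter)
  next
    case False
    with Suc.prems have less: "?a < t" by auto
    from Suc obtain j where "\<forall>\<^sub>F s in at_left (t - ?a). jumps j s (stl \<omega>)" by fastforce
    then have "\<forall>\<^sub>F s in at_left t. jumps j (s - ?a) (stl \<omega>)"
      unfolding filtermap_at_left_shift[symmetric] eventually_filtermap .
    moreover have "\<forall>\<^sub>F s in at_left t. ?a < s"
      by (rule order_tendstoD(1)[OF tendsto_ident_at less])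
    ultimately have "\<forall>\<^sub>F s in at_left t. jumps (Suc j) s \<omega>" by eventually_elim auto
    then show ?thesis ..
  qed
qed

abbreviation epoch_law :: "(real \<times> 'm) measure" where
  "epoch_law \<equiv> density lborel (exponential_density L) \<Otimes>\<^sub>M measure_pmf \<mu>"

lemma sets_epoch_law[measurable_cong]: "sets epoch_law = sets (borel \<Otimes>\<^sub>M count_space UNIV)"
  by (intro sets_pair_measure_cong) auto

lemma prob_space_epoch_law: "prob_space epoch_law"
  by (intro prob_space_pair prob_space_exponential_density L_pos prob_space_measure_pmf)

sublocale epoch_law: prob_space epoch_law by (rule prob_space_epoch_law)

abbreviation \<Omega> :: "(real \<times> 'm) stream measure" where "\<Omega> \<equiv> stream_space epoch_law"

sublocale prob_space \<Omega> by (rule epoch_law.prob_space_stream_space)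

lemma space_\<Omega>[simp]: "space \<Omega> = UNIV"
  by (simp add: space_stream_space space_pair_measure)

lemma measurable_T:
  assumes m: "m \<in> N \<rightarrow>\<^sub>M count_space UNIV" and c: "c \<in> N \<rightarrow>\<^sub>M count_space UNIV"
  shows "(\<lambda>z. T (m z) (c z)) \<in> N \<rightarrow>\<^sub>M count_space UNIV"
  by (rule measurable_compose_countable[where g=c, OF _ c])
    (rule measurable_compose[OF m], simp)

lemma measurable_fst_shd[measurable (raw)]:
  assumes b: "b \<in> N \<rightarrow>\<^sub>M \<Omega>"
  shows "(\<lambda>z. fst (shd (b z))) \<in> borel_measurable N"
proof -
  have "fst \<in> epoch_law \<rightarrow>\<^sub>M borel"
    by (simp add: measurable_cong_sets[OF sets_epoch_law refl])
  from measurable_compose[OF measurable_compose[OF b measurable_shd] this] show ?thesis .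
qed

lemma measurable_snd_shd[measurable (raw)]:
  assumes b: "b \<in> N \<rightarrow>\<^sub>M \<Omega>"
  shows "(\<lambda>z. snd (shd (b z))) \<in> N \<rightarrow>\<^sub>M count_space UNIV"
proof -
  have "snd \<in> epoch_law \<rightarrow>\<^sub>M count_space UNIV"
    by (simp add: measurable_cong_sets[OF sets_epoch_law refl])
  from measurable_compose[OF measurable_compose[OF b measurable_shd] this] show ?thesis .
qed

lemma measurable_jumps[measurable (raw)]:
  "a \<in> borel_measurable N \<Longrightarrow> b \<in> N \<rightarrow>\<^sub>M \<Omega> \<Longrightarrow> Measurable.pred N (\<lambda>z. jumps k (a z) (b z))"
proof (induction k arbitrary: a b)
  case 0
  note [measurable] = 0
  show ?case by simp
next
  case (Suc k)
  note [measurable] = Suc.prems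
  have [measurable]: "Measurable.pred N (\<lambda>z. jumps k (a z - fst (shd (b z))) (stl (b z)))"
    by (rule Suc.IH) measurable
  show ?case by simp
qed

lemma measurable_state_after[measurable (raw)]:
  "c \<in> N \<rightarrow>\<^sub>M count_space UNIV \<Longrightarrow> b \<in> N \<rightarrow>\<^sub>M \<Omega> \<Longrightarrow>
    (\<lambda>z. state_after k (c z) (b z)) \<in> N \<rightarrow>\<^sub>M count_space UNIV"
proof (induction k arbitrary: c b)
  case 0
  then show ?case by simp
next
  case (Suc k)
  note [measurable] = Suc.prems
  show ?case unfolding state_after.simps
    by (rule Suc.IH) (auto intro!: measurable_T measurable_snd_shd)
qed

lemma measurable_future[measurable (raw)]:
  "a \<in> borel_measurable N \<Longrightarrow> b \<in> N \<rightarrow>\<^sub>M \<Omega> \<Longrightarrow> (\<lambda>z. future k (a z) (b z)) \<in> N \<rightarrow>\<^sub>M \<Omega>"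
proof (induction k arbitrary: a b)
  case 0
  note [measurable] = 0
  show ?case by simp
next
  case (Suc k)
  note [measurable] = Suc.prems
  show ?case unfolding future.simps by (rule Suc.IH) measurable
qed

section \<open>Regeneration of the marked Poisson process\<close>

text \<open>The probability that a Poisson process of rate \<open>L\<close> has \<open>k\<close> points in an interval of length \<open>t\<close>.\<close>
definition poisson_weight :: "nat \<Rightarrow> real \<Rightarrow> real" where
  "poisson_weight k t = exp (- (L * t)) * (L * t) ^ k / fact k"

lemma poisson_weight_nonneg: "0 \<le> t \<Longrightarrow> 0 \<le> poisson_weight k t"
  using L_pos by (simp add: poisson_weight_def)

text \<open>
  The law of the state after \<open>k\<close> updates.  The recursion splits off the first update, since the
  regeneration argument conditions on the first epoch.
\<close>
primrec step_law :: "nat \<Rightarrow> 's \<Rightarrow> 's pmf" where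
  "step_law 0 x = return_pmf x"
| "step_law (Suc k) x = bind_pmf \<mu> (\<lambda>m. step_law k (T m x))"

lemma nn_integral_exponential_memoryless:
  assumes [measurable]: "h \<in> borel_measurable borel" and t: "0 \<le> t"
  shows "(\<integral>\<^sup>+u. (if t < u then h (u - t) else 0) \<partial>density lborel (exponential_density L)) =
    ennreal (poisson_weight 0 t) * (\<integral>\<^sup>+u. h u \<partial>density lborel (exponential_density L))"
proof -
  have "(\<integral>\<^sup>+u. (if t < u then h (u - t) else 0) \<partial>density lborel (exponential_density L)) =
    (\<integral>\<^sup>+u. ennreal (exponential_density L u) * (if t < u then h (u - t) else 0) \<partial>lborel)"
    by (subst nn_integral_density) simp_all
  also have "\<dots> = (\<integral>\<^sup>+u. ennreal (exponential_density L (t + u)) * (if 0 < u then h u else 0) \<partial>lborel)"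
    by (subst nn_integral_real_affine[where c=1 and t=t]) (simp_all cong: if_cong)
  also have "\<dots> = (\<integral>\<^sup>+u. ennreal (poisson_weight 0 t) * (ennreal (exponential_density L u) * h u) \<partial>lborel)"
  proof (rule nn_integral_cong_AE)
    \<comment> \<open>At \<open>u = 0\<close> the two sides may differ: the left one vanishes, but the density on the right is \<open>L\<close>.\<close>
    have *: "ennreal (exponential_density L (t + u)) * (if 0 < u then h u else 0) =
        ennreal (poisson_weight 0 t) * (ennreal (exponential_density L u) * h u)" if "u \<noteq> 0" for u
    proof (cases "0 < u")
      case True
      have "exponential_density L (t + u) = poisson_weight 0 t * exponential_density L u"
        using True t by (simp add: exponential_density_def poisson_weight_def mult_exp_exp) (simp add: algebra_simps)
      then show ?thesis
        using True poisson_weight_nonneg[OF t, of 0] by (simp add: ennreal_mult' mult.assoc)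
    next
      case False
      with that show ?thesis by (simp add: exponential_density_def)
    qed
    show "AE u in lborel. ennreal (exponential_density L (t + u)) * (if 0 < u then h u else 0) =
        ennreal (poisson_weight 0 t) * (ennreal (exponential_density L u) * h u)"
      using AE_lborel_singleton[of 0] by eventually_elim (rule *)
  qed
  also have "\<dots> = ennreal (poisson_weight 0 t) * (\<integral>\<^sup>+u. h u \<partial>density lborel (exponential_density L))"
    by (simp add: nn_integral_cmult nn_integral_density)
  finally show ?thesis .
qed

text \<open>
  Conditioning on the first epoch \<open>u\<close> turns \<open>k\<close> epochs in the remaining time \<open>t - u\<close> into \<open>k + 1\<close> epochs
  up to \<open>t\<close>; the exponential factors combine to \<open>exp (- (L * t))\<close>, and a power of \<open>t - u\<close> remains to be
  integrated.
\<close>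
lemma nn_integral_exponential_poisson_weight:
  assumes t: "0 \<le> t"
  shows "(\<integral>\<^sup>+u. (if u \<le> t then ennreal (poisson_weight k (t - u)) else 0) \<partial>density lborel (exponential_density L)) =
    ennreal (poisson_weight (Suc k) t)"
proof -
  let ?f = "\<lambda>u. L * exp (- (L * t)) * (L * (t - u)) ^ k / fact k"
  let ?F = "\<lambda>u. - exp (- (L * t)) * (L * (t - u)) ^ Suc k / fact (Suc k)"
  have [measurable]: "(\<lambda>u. poisson_weight k (t - u)) \<in> borel_measurable borel" by (simp add: poisson_weight_def)
  have "(\<integral>\<^sup>+u. (if u \<le> t then ennreal (poisson_weight k (t - u)) else 0) \<partial>density lborel (exponential_density L)) =
    (\<integral>\<^sup>+u. ennreal (exponential_density L u) * (if u \<le> t then ennreal (poisson_weight k (t - u)) else 0) \<partial>lborel)"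
    by (subst nn_integral_density) simp_all
  also have "\<dots> = (\<integral>\<^sup>+u. ennreal (?f u) * indicator {0..t} u \<partial>lborel)"
    using L_pos
    by (intro nn_integral_cong)
      (auto simp: exponential_density_def poisson_weight_def indicator_def ennreal_mult'[symmetric] mult_exp_exp
        field_simps)
  also have "\<dots> = ennreal (?F t - ?F 0)"
  proof (rule nn_integral_FTC_Icc)
    show "(?F has_real_derivative ?f u) (at u)" if "u \<in> {0..t}" for u
      by (rule derivative_eq_intros refl | simp)+
    show "0 \<le> ?f u" if "u \<in> {0..t}" for u using that L_pos by auto
  qed (use t in auto)
  also have "?F t - ?F 0 = poisson_weight (Suc k) t" by (simp add: poisson_weight_def)
  finally show ?thesis .
qed

lemma nn_integral_epoch_law:
  assumes "f \<in> borel_measurable epoch_law"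
  shows "(\<integral>\<^sup>+p. f p \<partial>epoch_law) = (\<integral>\<^sup>+u. \<integral>\<^sup>+m. f (u, m) \<partial>\<mu> \<partial>density lborel (exponential_density L))"
  using sigma_finite_measure.nn_integral_fst[OF prob_space_imp_sigma_finite[OF measure_pmf.prob_space_axioms] assms] by simp

lemma measurable_random_index:
  assumes "\<And>y. g y \<in> M \<rightarrow>\<^sub>M K" "s \<in> N \<rightarrow>\<^sub>M count_space (UNIV :: 's set)" "f \<in> N \<rightarrow>\<^sub>M M"
  shows "(\<lambda>z. g (s z) (f z)) \<in> N \<rightarrow>\<^sub>M K"
  by (rule measurable_compose_countable[where g=s, OF _ assms(2)])
    (rule measurable_compose[OF assms(3) assms(1)])

text \<open>
  On the event of \<open>k\<close> epochs up to \<open>t\<close>, the state and the future factorize, and the future is a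
  fresh copy of the driving stream.  For \<open>k = 0\<close> this is memorylessness.  For \<open>k + 1\<close>, reading off
  the first pair leaves an independent stream, a start in \<open>T m x\<close> and the time horizon \<open>t - u\<close>, to
  which the induction hypothesis applies.
\<close>
theorem nn_integral_regeneration:
  assumes g: "\<And>y. g y \<in> borel_measurable \<Omega>" and t: "0 \<le> t"
  shows "(\<integral>\<^sup>+\<omega>. (if jumps k t \<omega> then g (state_after k x \<omega>) (future k t \<omega>) else 0) \<partial>\<Omega>) =
    ennreal (poisson_weight k t) * (\<integral>\<^sup>+y. (\<integral>\<^sup>+\<omega>. g y \<omega> \<partial>\<Omega>) \<partial>step_law k x)"
  using t
proof (induction k arbitrary: t x)
  case 0
  note [measurable] = g
  define h where "h p = (\<integral>\<^sup>+\<omega>. g x (p ## \<omega>) \<partial>\<Omega>)" for p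
  have hm[measurable]: "h \<in> borel_measurable (borel \<Otimes>\<^sub>M count_space UNIV)"
    unfolding h_def measurable_cong_sets[OF sets_epoch_law[symmetric] refl] by measurable
  have "(\<integral>\<^sup>+\<omega>. (if jumps 0 t \<omega> then g (state_after 0 x \<omega>) (future 0 t \<omega>) else 0) \<partial>\<Omega>) =
    (\<integral>\<^sup>+p. \<integral>\<^sup>+\<omega>. (if t < fst p then g x ((fst p - t, snd p) ## \<omega>) else 0) \<partial>\<Omega> \<partial>epoch_law)"
    by (subst epoch_law.nn_integral_stream_space) (simp_all cong: if_cong)
  also have "\<dots> = (\<integral>\<^sup>+p. (if t < fst p then h (fst p - t, snd p) else 0) \<partial>epoch_law)"
    by (intro nn_integral_cong) (simp add: h_def)
  also have "\<dots> = (\<integral>\<^sup>+u. \<integral>\<^sup>+m. (if t < u then h (u - t, m) else 0) \<partial>\<mu> \<partial>density lborel (exponential_density L))"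
    by (subst nn_integral_epoch_law) (simp_all cong: if_cong)
  also have "\<dots> = (\<integral>\<^sup>+u. (if t < u then \<integral>\<^sup>+m. h (u - t, m) \<partial>\<mu> else 0) \<partial>density lborel (exponential_density L))"
    by (intro nn_integral_cong) simp
  also have "\<dots> = ennreal (poisson_weight 0 t) * (\<integral>\<^sup>+u. \<integral>\<^sup>+m. h (u, m) \<partial>\<mu> \<partial>density lborel (exponential_density L))"
    using 0 by (rule nn_integral_exponential_memoryless[rotated]) measurable
  also have "(\<integral>\<^sup>+u. \<integral>\<^sup>+m. h (u, m) \<partial>\<mu> \<partial>density lborel (exponential_density L)) = (\<integral>\<^sup>+p. h p \<partial>epoch_law)"
    by (subst nn_integral_epoch_law) simp_all
  also have "\<dots> = (\<integral>\<^sup>+\<omega>. g x \<omega> \<partial>\<Omega>)"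
    unfolding h_def by (subst epoch_law.nn_integral_stream_space) simp_all
  finally show ?case by simp
next
  case (Suc k)
  define C where "C y = (\<integral>\<^sup>+z. (\<integral>\<^sup>+\<omega>. g z \<omega> \<partial>\<Omega>) \<partial>step_law k y)" for y
  have [measurable]: "(\<lambda>u. poisson_weight k (t - u)) \<in> borel_measurable borel" by (simp add: poisson_weight_def)
  have "(\<integral>\<^sup>+\<omega>. (if jumps (Suc k) t \<omega> then g (state_after (Suc k) x \<omega>) (future (Suc k) t \<omega>) else 0) \<partial>\<Omega>) =
    (\<integral>\<^sup>+p. \<integral>\<^sup>+\<omega>. (if fst p \<le> t then if jumps k (t - fst p) \<omega>
       then g (state_after k (T (snd p) x) \<omega>) (future k (t - fst p) \<omega>) else 0 else 0) \<partial>\<Omega> \<partial>epoch_law)"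
  proof (subst epoch_law.nn_integral_stream_space)
    have [measurable]: "(\<lambda>\<omega>. g (state_after (Suc k) x \<omega>) (future (Suc k) t \<omega>)) \<in> borel_measurable \<Omega>"
      by (rule measurable_random_index[OF g]) measurable
    show "(\<lambda>\<omega>. if jumps (Suc k) t \<omega> then g (state_after (Suc k) x \<omega>) (future (Suc k) t \<omega>) else 0)
        \<in> borel_measurable \<Omega>"
      by measurable
  qed (intro nn_integral_cong, simp)
  also have "\<dots> = (\<integral>\<^sup>+p. (if fst p \<le> t then ennreal (poisson_weight k (t - fst p)) else 0) * C (T (snd p) x) \<partial>epoch_law)"
  proof (intro nn_integral_cong)
    fix p
    show "(\<integral>\<^sup>+\<omega>. (if fst p \<le> t then if jumps k (t - fst p) \<omega>
       then g (state_after k (T (snd p) x) \<omega>) (future k (t - fst p) \<omega>) else 0 else 0) \<partial>\<Omega>) =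
      (if fst p \<le> t then ennreal (poisson_weight k (t - fst p)) else 0) * C (T (snd p) x)"
    proof (cases "fst p \<le> t")
      case True
      then show ?thesis using Suc.IH[of "t - fst p" "T (snd p) x"] by (simp only: if_True C_def)
    qed simp
  qed
  also have "\<dots> = (\<integral>\<^sup>+u. \<integral>\<^sup>+m. (if u \<le> t then ennreal (poisson_weight k (t - u)) else 0) * C (T m x) \<partial>\<mu> \<partial>density lborel (exponential_density L))"
  proof (subst nn_integral_epoch_law)
    have [measurable]: "(\<lambda>p. C (T (snd p) x)) \<in> borel_measurable epoch_law"
      unfolding measurable_cong_sets[OF sets_epoch_law refl]
      by (rule measurable_compose[OF measurable_snd]) simp
    show "(\<lambda>p. (if fst p \<le> t then ennreal (poisson_weight k (t - fst p)) else 0) * C (T (snd p) x)) \<in> borel_measurable epoch_law"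
      by measurable
  qed (simp cong: if_cong)
  also have "\<dots> = (\<integral>\<^sup>+u. (if u \<le> t then ennreal (poisson_weight k (t - u)) else 0) * (\<integral>\<^sup>+m. C (T m x) \<partial>\<mu>) \<partial>density lborel (exponential_density L))"
    by (simp add: nn_integral_cmult)
  also have "\<dots> = ennreal (poisson_weight (Suc k) t) * (\<integral>\<^sup>+m. C (T m x) \<partial>\<mu>)"
    using Suc.prems by (subst nn_integral_multc) (simp_all add: nn_integral_exponential_poisson_weight)
  also have "(\<integral>\<^sup>+m. C (T m x) \<partial>\<mu>) = (\<integral>\<^sup>+z. (\<integral>\<^sup>+\<omega>. g z \<omega> \<partial>\<Omega>) \<partial>step_law (Suc k) x)"
    by (simp add: C_def nn_integral_bind_pmf)
  finally show ?case .
qed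

section \<open>The transition semigroup and the finite-dimensional laws\<close>

text \<open>The case distinction is there because \<open>poisson_pmf\<close> requires a positive rate.\<close>
definition law :: "real \<Rightarrow> 's \<Rightarrow> 's pmf" where
  "law t x = (if t = 0 then return_pmf x else bind_pmf (poisson_pmf (L * t)) (\<lambda>k. step_law k x))"

lemma nn_integral_law:
  assumes "0 \<le> t"
  shows "(\<integral>\<^sup>+y. f y \<partial>law t x) = (\<Sum>k. ennreal (poisson_weight k t) * (\<integral>\<^sup>+y. f y \<partial>step_law k x))"
proof (cases "t = 0")
  case True
  have "(\<Sum>k. ennreal (poisson_weight k 0) * (\<integral>\<^sup>+y. f y \<partial>step_law k x)) =
      (\<Sum>k\<in>{0}. ennreal (poisson_weight k 0) * (\<integral>\<^sup>+y. f y \<partial>step_law k x))"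
    by (rule suminf_finite) (simp_all add: poisson_weight_def)
  also have "\<dots> = f x" by (simp add: poisson_weight_def)
  finally show ?thesis using True by (simp add: law_def)
next
  case False
  with assms L_pos have pos: "0 < L * t" by simp
  have "(\<integral>\<^sup>+y. f y \<partial>law t x) = (\<integral>\<^sup>+k. (\<integral>\<^sup>+y. f y \<partial>step_law k x) \<partial>poisson_pmf (L * t))"
    using False by (simp add: law_def nn_integral_bind_pmf)
  also have "\<dots> = (\<Sum>k. ennreal (poisson_weight k t) * (\<integral>\<^sup>+y. f y \<partial>step_law k x))"
    unfolding nn_integral_measure_pmf[of "poisson_pmf (L * t)"] nn_integral_count_space_nat
    by (simp add: pmf_poisson[OF pos] poisson_weight_def algebra_simps)
  finally show ?thesis .
qed

lemma suminf_jumps: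
  assumes "jumps j t \<omega>"
  shows "(\<Sum>k. if jumps k t \<omega> then F k else (0::ennreal)) = F j"
proof -
  have "(\<Sum>k. if jumps k t \<omega> then F k else (0::ennreal)) = (\<Sum>k\<in>{j}. if jumps k t \<omega> then F k else 0)"
    using assms by (intro suminf_finite) (auto dest: jumps_unique)
  with assms show ?thesis by simp
qed

lemma nn_integral_regeneration_law:
  assumes g: "\<And>y. g y \<in> borel_measurable \<Omega>" and t: "0 \<le> t"
  shows "(\<integral>\<^sup>+\<omega>. (\<Sum>k. if jumps k t \<omega> then g (state_after k x \<omega>) (future k t \<omega>) else 0) \<partial>\<Omega>) =
    (\<integral>\<^sup>+y. (\<integral>\<^sup>+\<omega>. g y \<omega> \<partial>\<Omega>) \<partial>law t x)"
proof -
  have [measurable]: "(\<lambda>\<omega>. g (state_after k x \<omega>) (future k t \<omega>)) \<in> borel_measurable \<Omega>" for k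
    by (rule measurable_random_index[OF g]) measurable
  have "(\<integral>\<^sup>+\<omega>. (\<Sum>k. if jumps k t \<omega> then g (state_after k x \<omega>) (future k t \<omega>) else 0) \<partial>\<Omega>) =
    (\<Sum>k. \<integral>\<^sup>+\<omega>. (if jumps k t \<omega> then g (state_after k x \<omega>) (future k t \<omega>) else 0) \<partial>\<Omega>)"
    by (rule nn_integral_suminf) measurable
  also have "\<dots> = (\<Sum>k. ennreal (poisson_weight k t) * (\<integral>\<^sup>+y. (\<integral>\<^sup>+\<omega>. g y \<omega> \<partial>\<Omega>) \<partial>step_law k x))"
    by (intro suminf_cong nn_integral_regeneration g t)
  also have "\<dots> = (\<integral>\<^sup>+y. (\<integral>\<^sup>+\<omega>. g y \<omega> \<partial>\<Omega>) \<partial>law t x)"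
    by (rule nn_integral_law[OF t, symmetric])
  finally show ?thesis .
qed

lemma Collect_in_events: "Measurable.pred \<Omega> A \<Longrightarrow> {\<omega>. A \<omega>} \<in> events"
  by (simp add: pred_def)

text \<open>
  For fixed \<open>\<omega>\<close> at most one \<open>z\<close> qualifies, and none if infinitely many epochs precede \<open>t\<close>.  In
  this relational form the decomposition at an intermediate time (\<open>in_state_shift\<close>) holds for
  every \<open>\<omega>\<close> without discarding a null set.
\<close>
definition in_state :: "'s \<Rightarrow> real \<Rightarrow> (real \<times> 'm) stream \<Rightarrow> 's \<Rightarrow> bool" where
  "in_state x t \<omega> z \<longleftrightarrow> (\<exists>k. jumps k t \<omega> \<and> state_after k x \<omega> = z)"

lemma measurable_in_state[measurable (raw)]:
  assumes [measurable]: "a \<in> borel_measurable N" "b \<in> N \<rightarrow>\<^sub>M \<Omega>" "c \<in> N \<rightarrow>\<^sub>M count_space UNIV"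
  shows "Measurable.pred N (\<lambda>\<omega>. in_state (c \<omega>) (a \<omega>) (b \<omega>) z)"
  unfolding in_state_def by measurable

lemma in_state_shift:
  assumes "jumps k s \<omega>" "0 \<le> u"
  shows "in_state x (s + u) \<omega> z \<longleftrightarrow> in_state (state_after k x \<omega>) u (future k s \<omega>) z"
proof
  assume "in_state x (s + u) \<omega> z"
  then obtain m where "jumps m (s + u) \<omega>" "state_after m x \<omega> = z" by (auto simp: in_state_def)
  then show "in_state (state_after k x \<omega>) u (future k s \<omega>) z"
    using jumps_add[OF assms] state_after_add[of k m x \<omega> s] by (auto simp: in_state_def)
next
  assume "in_state (state_after k x \<omega>) u (future k s \<omega>) z"
  then obtain m where m: "jumps m u (future k s \<omega>)" "state_after m (state_after k x \<omega>) (future k s \<omega>) = z"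
    by (auto simp: in_state_def)
  then show "in_state x (s + u) \<omega> z"
    using jumps_add[OF assms, of "k + m"] state_after_add[of k "k + m" x \<omega> s]
    by (auto simp: in_state_def)
qed

lemma in_state_iff_jumps: "jumps k t \<omega> \<Longrightarrow> in_state x t \<omega> z \<longleftrightarrow> state_after k x \<omega> = z"
  by (auto simp: in_state_def dest: jumps_unique)

text \<open>
  The Markov property at time \<open>t\<close>: an event that is decided by the state at \<open>t\<close> and the stream
  after \<open>t\<close> is evaluated by restarting from a random state with law \<open>law t x\<close>.
\<close>
lemma emeasure_regeneration:
  assumes P: "\<And>y. Measurable.pred \<Omega> (P y)" and t: "0 \<le> t"
    and A: "\<And>k \<omega>. jumps k t \<omega> \<Longrightarrow> A \<omega> \<longleftrightarrow> P (state_after k x \<omega>) (future k t \<omega>)"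
      "\<And>\<omega>. A \<omega> \<Longrightarrow> \<exists>k. jumps k t \<omega>"
    and [measurable]: "Measurable.pred \<Omega> A"
  shows "emeasure \<Omega> {\<omega>. A \<omega>} = (\<integral>\<^sup>+y. emeasure \<Omega> {\<omega>. P y \<omega>} \<partial>law t x)"
proof -
  note [measurable] = P
  have "emeasure \<Omega> {\<omega>. A \<omega>} = (\<integral>\<^sup>+\<omega>. indicator {\<omega>. A \<omega>} \<omega> \<partial>\<Omega>)"
    by (subst nn_integral_indicator) (simp_all add: Collect_in_events)
  also have "\<dots> = (\<integral>\<^sup>+\<omega>. (\<Sum>k. if jumps k t \<omega>
      then indicator {\<omega>'. P (state_after k x \<omega>) \<omega>'} (future k t \<omega>) else 0) \<partial>\<Omega>)"
  proof (intro nn_integral_cong)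
    fix \<omega>
    show "indicator {\<omega>. A \<omega>} \<omega> = (\<Sum>k. if jumps k t \<omega>
      then indicator {\<omega>'. P (state_after k x \<omega>) \<omega>'} (future k t \<omega>) else 0 :: ennreal)"
    proof (cases "\<exists>k. jumps k t \<omega>")
      case True
      then obtain k where k: "jumps k t \<omega>" ..
      show ?thesis unfolding suminf_jumps[OF k] using A(1)[OF k] by (simp add: indicator_def)
    next
      case False
      then show ?thesis using A(2)[of \<omega>] by (auto simp: indicator_def)
    qed
  qed
  also have "\<dots> = (\<integral>\<^sup>+y. emeasure \<Omega> {\<omega>. P y \<omega>} \<partial>law t x)"
    by (subst nn_integral_regeneration_law[OF _ t, where g="\<lambda>y. indicator {\<omega>. P y \<omega>}"])
      (simp_all add: Collect_in_events P)
  finally show ?thesis .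
qed

text \<open>
  The waiting times do not accumulate before \<open>t\<close>, because the Poisson weights sum to one; this is regeneration
  applied to the sure event.
\<close>
lemma AE_jumps: "0 \<le> t \<Longrightarrow> AE \<omega> in \<Omega>. \<exists>k. jumps k t \<omega>"
  using emeasure_regeneration[of "\<lambda>_ _. True" t "\<lambda>\<omega>. \<exists>k. jumps k t \<omega>"]
  by (intro AE_I_eq_1) (auto simp: emeasure_space_1[simplified] intro!: Collect_in_events)

lemma emeasure_in_state: "0 \<le> t \<Longrightarrow> emeasure \<Omega> {\<omega>. in_state x t \<omega> z} = ennreal (pmf (law t x) z)"
proof -
  assume t: "0 \<le> t"
  have "emeasure \<Omega> {\<omega>. in_state x t \<omega> z} = (\<integral>\<^sup>+y. emeasure \<Omega> {\<omega>. y = z} \<partial>law t x)"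
    using t by (intro emeasure_regeneration) (auto simp: in_state_iff_jumps, auto simp: in_state_def)
  also have "\<dots> = (\<integral>\<^sup>+y. indicator {z} y \<partial>law t x)"
    by (intro nn_integral_cong) (auto simp: indicator_def emeasure_space_1[simplified])
  finally show ?thesis by (simp add: emeasure_pmf_single)
qed

lemma law_semigroup:
  assumes s: "0 \<le> s" and t: "0 \<le> t"
  shows "law (s + t) x = bind_pmf (law s x) (law t)"
proof (rule pmf_eqI)
  fix z
  have "ennreal (pmf (law (s + t) x) z) = emeasure \<Omega> {\<omega>. in_state x (s + t) \<omega> z}"
    using s t by (simp add: emeasure_in_state)
  also have "\<dots> = (\<integral>\<^sup>+y. emeasure \<Omega> {\<omega>. in_state y t \<omega> z} \<partial>law s x)"
  proof (rule emeasure_regeneration[OF _ s])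
    show "in_state x (s + t) \<omega> z \<Longrightarrow> \<exists>k. jumps k s \<omega>" for \<omega>
      using t by (auto simp: in_state_def intro: jumps_earlier)
  qed (simp_all add: in_state_shift[OF _ t])
  also have "\<dots> = ennreal (pmf (bind_pmf (law s x) (law t)) z)"
    using t by (simp add: emeasure_in_state ennreal_pmf_bind)
  finally show "pmf (law (s + t) x) z = pmf (bind_pmf (law s x) (law t)) z" by simp
qed

text \<open>
  Induction on the number of observation times, restarting at the first of them: the
  remaining observations are made of the fresh stream, from the state \<open>z 0\<close>, at the times
  \<open>t (Suc i) - t 0\<close>.
\<close>
theorem emeasure_finite_dimensional:
  assumes "0 \<le> t 0" "mono (t :: nat \<Rightarrow> real)"
  shows "emeasure \<Omega> {\<omega>. \<forall>i\<le>n. in_state x (t i) \<omega> (z i)} =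
    ennreal (pmf (law (t 0) x) (z 0) * (\<Prod>i<n. pmf (law (t (Suc i) - t i) (z i)) (z (Suc i))))"
  using assms
proof (induction n arbitrary: x t z)
  case 0
  then show ?case by (simp add: emeasure_in_state)
next
  case (Suc n)
  define c where "c = pmf (law (t 1 - t 0) (z 0)) (z 1) *
    (\<Prod>i<n. pmf (law (t (Suc (Suc i)) - t (Suc i)) (z (Suc i))) (z (Suc (Suc i))))"
  let ?P = "\<lambda>y \<omega>. y = z 0 \<and> (\<forall>i\<le>n. in_state (z 0) (t (Suc i) - t 0) \<omega> (z (Suc i)))"
  have tm: "0 \<le> t (Suc i) - t 0" for i using monoD[OF Suc.prems(2), of 0 "Suc i"] by simp
  have IH: "emeasure \<Omega> {\<omega>. \<forall>i\<le>n. in_state (z 0) (t (Suc i) - t 0) \<omega> (z (Suc i))} = ennreal c"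
    using Suc.IH[of "\<lambda>i. t (Suc i) - t 0" "z 0" "\<lambda>i. z (Suc i)"] Suc.prems(2) tm[of 0]
    by (simp add: c_def mono_def)
  have "emeasure \<Omega> {\<omega>. \<forall>i\<le>Suc n. in_state x (t i) \<omega> (z i)} = (\<integral>\<^sup>+y. emeasure \<Omega> {\<omega>. ?P y \<omega>} \<partial>law (t 0) x)"
  proof (rule emeasure_regeneration)
    fix k \<omega> assume k: "jumps k (t 0) \<omega>"
    have "(\<forall>i\<le>Suc n. in_state x (t i) \<omega> (z i)) \<longleftrightarrow>
        in_state x (t 0) \<omega> (z 0) \<and> (\<forall>i\<le>n. in_state x (t (Suc i)) \<omega> (z (Suc i)))"
      unfolding less_Suc_eq_le[symmetric] All_less_Suc2 by simp
    also have "\<dots> \<longleftrightarrow> ?P (state_after k x \<omega>) (future k (t 0) \<omega>)"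
      using in_state_shift[OF k tm] by (auto simp: in_state_iff_jumps[OF k])
    finally show "(\<forall>i\<le>Suc n. in_state x (t i) \<omega> (z i)) \<longleftrightarrow> ?P (state_after k x \<omega>) (future k (t 0) \<omega>)" .
  next
    fix \<omega> assume "\<forall>i\<le>Suc n. in_state x (t i) \<omega> (z i)"
    then have "in_state x (t 0) \<omega> (z 0)" by simp
    then show "\<exists>k. jumps k (t 0) \<omega>" by (auto simp: in_state_def)
  qed (use Suc.prems in simp_all)
  also have "\<dots> = (\<integral>\<^sup>+y. ennreal c * indicator {z 0} y \<partial>law (t 0) x)"
    by (intro nn_integral_cong) (auto simp: indicator_def IH)
  also have "\<dots> = ennreal c * ennreal (pmf (law (t 0) x) (z 0))"
    by (simp add: nn_integral_cmult emeasure_pmf_single)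
  finally show ?case
    unfolding c_def prod.lessThan_Suc_shift
    by (simp add: ennreal_mult'[symmetric] prod_nonneg mult.commute)
qed

definition rate :: "'s \<Rightarrow> 's \<Rightarrow> real" where
  "rate x y = L * (pmf (map_pmf (\<lambda>m. T m x) \<mu>) y - of_bool (y = x))"

text \<open>
  The transition probability is \<open>exp (- (L * t))\<close> times an everywhere convergent power series in \<open>t\<close>
  whose first two coefficients come from zero and one updates; only these matter for the derivative
  at \<open>0\<close>.
\<close>
lemma law_has_derivative: "((\<lambda>t. pmf (law t x) y) has_real_derivative rate x y) (at_right 0)"
proof -
  define c where "c k = L ^ k / fact k * pmf (step_law k x) y" for k
  have nonneg: "0 \<le> c k" for k using L_pos by (simp add: c_def)
  have summ: "summable (\<lambda>k. c k * t ^ k)" for t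
  proof (rule summable_comparison_test')
    show "summable (\<lambda>k. \<bar>L * t\<bar> ^ k / fact k)" using summable_exp[of "\<bar>L * t\<bar>"]
      by (simp add: field_simps divide_inverse [symmetric])
    show "norm (c k * t ^ k) \<le> \<bar>L * t\<bar> ^ k / fact k" for k
      using pmf_le_1[of "step_law k x" y] L_pos
      by (auto simp: c_def abs_mult power_mult_distrib power_abs field_simps intro!: mult_left_le)
  qed
  have eq: "pmf (law t x) y = exp (- (L * t)) * (\<Sum>k. c k * t ^ k)" if t: "0 \<le> t" for t
  proof -
    have "ennreal (pmf (law t x) y) = (\<integral>\<^sup>+z. indicator {y} z \<partial>law t x)"
      by (simp add: emeasure_pmf_single)
    also have "\<dots> = (\<Sum>k. ennreal (poisson_weight k t) * ennreal (pmf (step_law k x) y))"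
      by (simp add: nn_integral_law[OF t] emeasure_pmf_single)
    also have "\<dots> = (\<Sum>k. ennreal (exp (- (L * t)) * (c k * t ^ k)))"
      using t L_pos by (intro suminf_cong) (simp add: c_def poisson_weight_def ennreal_mult'[symmetric] power_mult_distrib)
    also have "\<dots> = ennreal (exp (- (L * t)) * (\<Sum>k. c k * t ^ k))"
      using nonneg t by (subst suminf_ennreal2) (auto intro!: summable_mult summ simp: suminf_mult[OF summ])
    finally show ?thesis using nonneg t by (simp add: suminf_nonneg summ)
  qed
  have "((\<lambda>t. exp (- (L * t)) * (\<Sum>k. c k * t ^ k)) has_real_derivative rate x y) (at 0 within {0..})"
  proof (rule has_field_derivative_at_within)
    have 1: "((\<lambda>t. \<Sum>k. c k * t ^ k) has_real_derivative (\<Sum>k. diffs c k * 0 ^ k)) (at 0)"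
      by (rule termdiffs_strong_converges_everywhere[OF summ])
    have 2: "c 0 = of_bool (y = x)" "diffs c 0 = L * pmf (map_pmf (\<lambda>m. T m x) \<mu>) y"
      by (auto simp: c_def diffs_def map_pmf_def)
    have "((\<lambda>t. exp (- (L * t)) * (\<Sum>k. c k * t ^ k)) has_real_derivative
        diffs c 0 - L * c 0) (at 0)"
      by (rule derivative_eq_intros 1 refl)+ (simp add: powser_zero)
    then show "((\<lambda>t. exp (- (L * t)) * (\<Sum>k. c k * t ^ k)) has_real_derivative rate x y) (at 0)"
      by (simp add: 2 rate_def algebra_simps)
  qed
  then have "((\<lambda>t. pmf (law t x) y) has_real_derivative rate x y) (at 0 within {0..})"
    by (rule has_field_derivative_transform_within[where d=1]) (auto simp: eq)
  then show ?thesis by (rule DERIV_subset) auto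
qed

lemma transition_semigroup_law: "transition_semigroup rate law"
  unfolding transition_semigroup_def
  by (auto simp: law_semigroup law_has_derivative) (simp add: law_def)

section \<open>The stochastic flow\<close>

text \<open>
  The first conjunct excludes an epoch at time \<open>0\<close>, so that the path starts in the prescribed state;
  the second says that the epochs do not accumulate.
\<close>
definition regular :: "(real \<times> 'm) stream \<Rightarrow> bool" where
  "regular \<omega> \<longleftrightarrow> jumps 0 0 \<omega> \<and> (\<forall>n. \<exists>k. jumps k (real n) \<omega>)"

text \<open>
  Outside the regular set, which has measure one, the path is frozen at its initial state, so that
  the path is right-continuous with left limits for every \<open>\<omega>\<close>.
\<close>
definition flow :: "'s \<Rightarrow> real \<Rightarrow> (real \<times> 'm) stream \<Rightarrow> 's" where
  "flow x t \<omega> = (if regular \<omega> then state_after (LEAST k. jumps k t \<omega>) x \<omega> else x)"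

lemma regular_jumps: "regular \<omega> \<Longrightarrow> \<exists>k. jumps k t \<omega>"
  using real_arch_simple[of t] jumps_earlier unfolding regular_def by blast

lemma Least_jumps: "jumps k t \<omega> \<Longrightarrow> (LEAST j. jumps j t \<omega>) = k"
  by (rule Least_equality) (auto dest: jumps_unique)

lemma flow_eq: "regular \<omega> \<Longrightarrow> jumps k t \<omega> \<Longrightarrow> flow x t \<omega> = state_after k x \<omega>"
  by (simp add: flow_def Least_jumps)

lemma in_state_iff_flow: "regular \<omega> \<Longrightarrow> in_state x t \<omega> z \<longleftrightarrow> flow x t \<omega> = z"
  using regular_jumps[of \<omega> t] by (auto simp: flow_eq in_state_iff_jumps)

lemma AE_regular: "AE \<omega> in \<Omega>. regular \<omega>"
proof -
  have "AE \<omega> in \<Omega>. jumps 0 0 \<omega>"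
  proof (intro AE_I_eq_1)
    have "emeasure \<Omega> {\<omega>. jumps 0 0 \<omega>} = (\<integral>\<^sup>+\<omega>. indicator {\<omega>. jumps 0 0 \<omega>} \<omega> \<partial>\<Omega>)"
      by (subst nn_integral_indicator) (simp_all del: jumps.simps add: Collect_in_events)
    also have "\<dots> = (\<integral>\<^sup>+\<omega>. (if jumps 0 0 \<omega> then 1 else 0) \<partial>\<Omega>)"
      by (intro nn_integral_cong) (simp add: indicator_def)
    also have "\<dots> = 1"
      using nn_integral_regeneration[of "\<lambda>_ _. 1" 0 0 undefined]
      by (simp del: jumps.simps add: poisson_weight_def emeasure_space_1[simplified])
    finally show "emeasure \<Omega> {\<omega> \<in> space \<Omega>. jumps 0 0 \<omega>} = 1" by (simp del: jumps.simps)
  qed (simp del: jumps.simps add: Collect_in_events)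
  moreover have "AE \<omega> in \<Omega>. \<forall>n. \<exists>k. jumps k (real n) \<omega>"
    by (simp add: AE_all_countable AE_jumps)
  ultimately show ?thesis by eventually_elim (simp add: regular_def)
qed

lemma flow_0[simp]: "flow x 0 \<omega> = x"
proof (cases "regular \<omega>")
  case True
  then have "jumps 0 0 \<omega>" by (simp add: regular_def)
  from flow_eq[OF True this] show ?thesis by simp
qed (simp add: flow_def)

lemma cadlag_flow: "cadlag_path (\<lambda>t. flow x t \<omega>)"
proof (cases "regular \<omega>")
  case True
  have "\<forall>\<^sub>F s in at_right t. flow x s \<omega> = flow x t \<omega>" for t
  proof -
    obtain k where k: "jumps k t \<omega>" using regular_jumps[OF True] ..
    from jumps_eventually_at_right[OF k] show ?thesis
      by eventually_elim (simp add: flow_eq[OF True] flow_eq[OF True k])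
  qed
  moreover have "\<exists>y. \<forall>\<^sub>F s in at_left t. flow x s \<omega> = y" for t
  proof -
    obtain k where k: "jumps k t \<omega>" using regular_jumps[OF True] ..
    from jumps_eventually_at_left[OF k] obtain j where "\<forall>\<^sub>F s in at_left t. jumps j s \<omega>" ..
    then have "\<forall>\<^sub>F s in at_left t. flow x s \<omega> = state_after j x \<omega>"
      by eventually_elim (simp add: flow_eq[OF True])
    then show ?thesis ..
  qed
  ultimately show ?thesis by (simp add: cadlag_path_def)
qed (simp add: cadlag_path_def flow_def)

lemma state_after_preserves:
  assumes "\<And>m x y. R x y \<Longrightarrow> R (T m x) (T m y)" and "R x y"
  shows "R (state_after k x \<omega>) (state_after k y \<omega>)"
  using assms(2) by (induction k arbitrary: x y \<omega>) (auto intro: assms(1))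

text \<open>
  The coupling argument: two paths read the same stream, so a relation that every update map
  respects is never lost.
\<close>
lemma flow_preserves:
  assumes "\<And>m x y. R x y \<Longrightarrow> R (T m x) (T m y)" and "R x y"
  shows "R (flow x t \<omega>) (flow y t \<omega>)"
  using state_after_preserves[of R, OF assms] assms(2) by (simp add: flow_def)

lemma measurable_flow:
  assumes [measurable]: "c \<in> N \<rightarrow>\<^sub>M count_space UNIV" "b \<in> N \<rightarrow>\<^sub>M \<Omega>"
  shows "(\<lambda>z. flow (c z) t (b z)) \<in> N \<rightarrow>\<^sub>M count_space UNIV"
proof -
  have [measurable]: "(\<lambda>z. LEAST k. jumps k t (b z)) \<in> N \<rightarrow>\<^sub>M count_space UNIV"
    by (rule measurable_Least) measurable
  have [measurable]: "(\<lambda>z. state_after (LEAST k. jumps k t (b z)) (c z) (b z)) \<in> N \<rightarrow>\<^sub>M count_space UNIV"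
    by (rule measurable_compose_countable[where g="\<lambda>z. LEAST k. jumps k t (b z)"]) measurable
  show ?thesis unfolding flow_def regular_def by measurable
qed

text \<open>
  The initial state \<open>Z\<close> lives on a separate factor and is thus independent of the stream; the
  finite-dimensional laws follow by integrating those for a fixed initial state over \<open>Z\<close>.
\<close>
theorem markov_chain_flow:
  assumes "prob_space M" and Z[measurable]: "Z \<in> M \<rightarrow>\<^sub>M count_space UNIV"
  shows "markov_chain_with_rates rate (M \<Otimes>\<^sub>M \<Omega>) (\<lambda>t p. flow (Z (fst p)) t (snd p))"
proof -
  interpret M: prob_space M by fact
  interpret N: prob_space "M \<Otimes>\<^sub>M \<Omega>" by (intro prob_space_pair M.prob_space_axioms prob_space_axioms)
  note [measurable] = measurable_flow
  have fdd: "emeasure (M \<Otimes>\<^sub>M \<Omega>) {p \<in> space (M \<Otimes>\<^sub>M \<Omega>). \<forall>i\<le>n. flow (Z (fst p)) (t i) (snd p) = x i} =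
      (\<integral>\<^sup>+\<omega>. ennreal (pmf (law (t 0) (Z \<omega>)) (x 0)) \<partial>M) *
        ennreal (\<Prod>i<n. pmf (law (t (Suc i) - t i) (x i)) (x (Suc i)))"
    if t: "0 \<le> t 0" "mono t" for n x and t :: "nat \<Rightarrow> real"
  proof -
    let ?A = "{p \<in> space (M \<Otimes>\<^sub>M \<Omega>). \<forall>i\<le>n. flow (Z (fst p)) (t i) (snd p) = x i}"
    have "emeasure (M \<Otimes>\<^sub>M \<Omega>) ?A = (\<integral>\<^sup>+\<omega>. emeasure \<Omega> (Pair \<omega> -` ?A) \<partial>M)"
      by (rule emeasure_pair_measure_alt) measurable
    also have "\<dots> = (\<integral>\<^sup>+\<omega>. emeasure \<Omega> {\<omega>'. \<forall>i\<le>n. in_state (Z \<omega>) (t i) \<omega>' (x i)} \<partial>M)"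
    proof (intro nn_integral_cong emeasure_eq_AE)
      fix \<omega> assume \<omega>: "\<omega> \<in> space M"
      show "AE \<omega>' in \<Omega>. \<omega>' \<in> Pair \<omega> -` ?A \<longleftrightarrow> \<omega>' \<in> {\<omega>'. \<forall>i\<le>n. in_state (Z \<omega>) (t i) \<omega>' (x i)}"
        using AE_regular by eventually_elim (simp add: in_state_iff_flow \<omega> space_pair_measure)
      show "Pair \<omega> -` ?A \<in> events" by (rule sets_Pair1) measurable
      show "{\<omega>'. \<forall>i\<le>n. in_state (Z \<omega>) (t i) \<omega>' (x i)} \<in> events"
        by (rule Collect_in_events) measurable
    qed
    also have "\<dots> = (\<integral>\<^sup>+\<omega>. ennreal (pmf (law (t 0) (Z \<omega>)) (x 0)) *
        ennreal (\<Prod>i<n. pmf (law (t (Suc i) - t i) (x i)) (x (Suc i))) \<partial>M)"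
      by (intro nn_integral_cong) (simp add: emeasure_finite_dimensional[where t=t, OF t] ennreal_mult' prod_nonneg)
    also have "\<dots> = (\<integral>\<^sup>+\<omega>. ennreal (pmf (law (t 0) (Z \<omega>)) (x 0)) \<partial>M) *
        ennreal (\<Prod>i<n. pmf (law (t (Suc i) - t i) (x i)) (x (Suc i)))"
      by (rule nn_integral_multc) (rule measurable_compose[OF Z], simp)
    finally show ?thesis .
  qed
  have "measure (M \<Otimes>\<^sub>M \<Omega>) {p \<in> space (M \<Otimes>\<^sub>M \<Omega>). \<forall>i\<le>n. flow (Z (fst p)) (t i) (snd p) = x i} =
      measure (M \<Otimes>\<^sub>M \<Omega>) {p \<in> space (M \<Otimes>\<^sub>M \<Omega>). flow (Z (fst p)) (t 0) (snd p) = x 0} *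
        (\<Prod>i<n. pmf (law (t (Suc i) - t i) (x i)) (x (Suc i)))"
    if t: "0 \<le> t 0" "mono t" for n x and t :: "nat \<Rightarrow> real"
    using fdd[OF t, of n x] fdd[OF t, of 0 x]
    by (simp add: measure_def enn2real_mult prod_nonneg)
  then show ?thesis
    unfolding markov_chain_with_rates_def
    using transition_semigroup_law
    by (auto simp: cadlag_flow N.prob_space_axioms intro!: measurable_flow exI[of _ law])
qed

end

section \<open>Join-the-shortest-queue as random monotone updates\<close>

lemma find_first_unique:
  "List.find P l = Some a \<Longrightarrow> List.find Q l = Some b \<Longrightarrow> Q a \<Longrightarrow> P b \<Longrightarrow> a = b"
  by (induction l) (auto split: if_splits)

lemma find_map_invariant:
  "(\<And>v. P (f v) \<longleftrightarrow> P v) \<Longrightarrow> List.find P (map f l) = map_option f (List.find P l)"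
  by (induction l) auto

text \<open>
  A random priority list selects uniformly from every nonempty \<open>A\<close>: exchanging two members of \<open>A\<close> in the
  list preserves the uniform law of the list and exchanges the selected members.
\<close>
lemma find_random_permutation:
  fixes A :: "'v::finite set"
  assumes "A \<noteq> {}"
  shows "map_pmf (List.find (\<lambda>v. v \<in> A)) (pmf_of_set (permutations_of_set UNIV)) = map_pmf Some (pmf_of_set A)"
proof -
  let ?perms = "pmf_of_set (permutations_of_set (UNIV :: 'v set))"
  let ?p = "map_pmf (List.find (\<lambda>v. v \<in> A)) ?perms"
  have ne: "permutations_of_set (UNIV :: 'v set) \<noteq> {}" by simp
  have sym: "pmf ?p (Some a) = pmf ?p (Some b)" if "a \<in> A" "b \<in> A" for a b
  proof -
    let ?\<tau> = "Transposition.transpose a b"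
    have "map_pmf (map ?\<tau>) ?perms = pmf_of_set (map ?\<tau> ` permutations_of_set UNIV)"
      by (rule map_pmf_of_set_inj) (auto intro: inj_on_subset[OF inj_mapI])
    also have "map ?\<tau> ` permutations_of_set UNIV = permutations_of_set (UNIV :: 'v set)"
      by (rule permutations_of_set_image_permutes) (simp add: permutes_swap_id)
    finally have inv: "map_pmf (map ?\<tau>) ?perms = ?perms" .
    have mem: "?\<tau> v \<in> A \<longleftrightarrow> v \<in> A" for v
      using that by (auto simp: Transposition.transpose_def)
    have "?p = map_pmf (List.find (\<lambda>v. v \<in> A)) (map_pmf (map ?\<tau>) ?perms)" by (simp only: inv)
    also have "\<dots> = map_pmf (map_option ?\<tau>) ?p"
      by (simp add: pmf.map_comp o_def find_map_invariant[where P="\<lambda>v. v \<in> A", OF mem])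
    finally have "pmf ?p (Some a) = pmf (map_pmf (map_option ?\<tau>) ?p) (map_option ?\<tau> (Some b))"
      by simp
    also have "\<dots> = pmf ?p (Some b)"
      by (rule pmf_map_inj') (simp add: option.inj_map)
    finally show ?thesis .
  qed
  have sub: "set_pmf ?p \<subseteq> Some ` A"
  proof
    fix r assume "r \<in> set_pmf ?p"
    then obtain l where "l \<in> permutations_of_set UNIV" "r = List.find (\<lambda>v. v \<in> A) l"
      by (auto simp: set_pmf_of_set[OF ne])
    then have "set l = UNIV" "r = List.find (\<lambda>v. v \<in> A) l"
      by (simp_all add: permutations_of_set_def)
    with assms show "r \<in> Some ` A"
      by (cases r) (auto simp: find_None_iff2 find_Some_iff2)
  qed
  obtain a where a: "a \<in> A" using assms by auto
  have "1 = (\<Sum>r\<in>Some ` A. pmf ?p r)" using sub by (intro sum_pmf_eq_1[symmetric]) auto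
  also have "\<dots> = (\<Sum>r\<in>Some ` A. pmf ?p (Some a))" using sym[OF _ a] by (intro sum.cong) auto
  also have "\<dots> = real (card A) * pmf ?p (Some a)" by (simp add: card_image)
  finally have c: "pmf ?p (Some a) = 1 / real (card A)" using assms by (simp add: field_simps)
  have "?p = pmf_of_set (Some ` A)"
  proof (rule pmf_eqI)
    fix r
    show "pmf ?p r = pmf (pmf_of_set (Some ` A)) r"
    proof (cases "r \<in> Some ` A")
      case True
      then have "pmf ?p r = 1 / real (card A)" using sym[OF _ a] c by auto
      then show ?thesis using True assms by (simp add: card_image)
    next
      case False
      with sub have "pmf ?p r = 0" by (meson pmf_eq_0_set_pmf subsetD)
      then show ?thesis using False assms by simp
    qed
  qed
  also have "\<dots> = map_pmf Some (pmf_of_set A)"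
    using assms by (intro map_pmf_of_set_inj[symmetric]) auto
  finally show ?thesis .
qed

text \<open>
  \<open>Inl (S, l)\<close> is an arrival that samples the set \<open>S\<close> of servers and breaks ties by the priority list
  \<open>l\<close>; \<open>Inr v\<close> is a service completion at \<open>v\<close>, which has no effect on an empty queue because of
  truncated subtraction.
\<close>
fun queue_step :: "('v set \<times> 'v list) + 'v \<Rightarrow> ('v \<Rightarrow> nat) \<Rightarrow> 'v \<Rightarrow> nat" where
  "queue_step (Inl (S, l)) x =
     (case List.find (\<lambda>v. v \<in> {v \<in> S. \<forall>u\<in>S. x v \<le> x u}) l of None \<Rightarrow> x | Some v \<Rightarrow> x(v := x v + 1))"
| "queue_step (Inr v) x = x(v := x v - 1)"

text \<open>
  For an arrival, let \<open>a\<close> be the server joined in the state \<open>x\<close>.  If \<open>a\<close> is not among the shortest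
  sampled queues in \<open>y\<close>, then some sampled \<open>b\<close> has \<open>x a \<le> x b \<le> y b < y a\<close>.  If \<open>a\<close> is among
  them but a different server \<open>b\<close> is joined in \<open>y\<close>, then \<open>x a = y a\<close> would give
  \<open>x b \<le> y b = y a = x a\<close>; both servers would be tied in both states, and the common list would select the
  same one.  So \<open>x a < y a\<close> in either case, which leaves room for the new task.
\<close>
lemma queue_step_mono:
  assumes "\<forall>v. x v \<le> y v"
  shows "\<forall>v. queue_step m x v \<le> queue_step m y v"
proof (cases m)
  case (Inr v)
  then show ?thesis using assms by (auto intro: diff_le_mono)
next
  case (Inl p)
  then obtain S l where m: "m = Inl (S, l)" by (cases p) auto
  let ?A = "\<lambda>v. v \<in> {v \<in> S. \<forall>u\<in>S. x v \<le> x u}" and ?B = "\<lambda>v. v \<in> {v \<in> S. \<forall>u\<in>S. y v \<le> y u}"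
  show ?thesis
  proof (cases "List.find ?A l")
    case None
    then show ?thesis using assms by (auto simp: m le_SucI split: option.split)
  next
    case (Some a)
    then have a: "a \<in> set l" "?A a" by (auto simp: find_Some_iff)
    have "x a < y a \<or> List.find ?B l = Some a"
    proof (rule disjCI)
      assume "List.find ?B l \<noteq> Some a"
      show "x a < y a"
      proof (cases "?B a")
        case False
        with a obtain b where "b \<in> S" "y b < y a" by (auto simp: not_le)
        moreover have "x a \<le> x b" "x b \<le> y b" using a(2) \<open>b \<in> S\<close> assms by auto
        ultimately show ?thesis by linarith
      next
        case True
        with a(1) obtain b where b: "List.find ?B l = Some b"
          by (cases "List.find ?B l") (auto simp: find_None_iff)
        then have "?B b" by (auto simp: find_Some_iff)
        show ?thesis
        proof (rule ccontr)
          assume "\<not> x a < y a"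
          with assms have eq: "x a = y a" by (simp add: le_antisym not_less)
          have "x b \<le> x u" if "u \<in> S" for u
          proof -
            have "x b \<le> y b" "y b \<le> y a" "x a \<le> x u"
              using assms \<open>?B b\<close> True a(2) that by auto
            with eq show ?thesis by linarith
          qed
          with \<open>?B b\<close> have "?A b" by auto
          from find_first_unique[OF Some b True this] b \<open>List.find ?B l \<noteq> Some a\<close>
          show False by simp
        qed
      qed
    qed
    then show ?thesis using assms Some
      by (auto simp: m le_SucI Suc_le_eq less_Suc_eq_le split: option.split)
  qed
qed

text \<open>
  With total rate \<open>(lam + 1) * N\<close>, the probability \<open>lam / (lam + 1)\<close> gives arrivals the rate
  \<open>lam * N\<close>, shared equally by the task types, and each server attempts a service completion at rate one.
\<close>
definition queue_mark ::
    "real \<Rightarrow> nat \<Rightarrow> ('v::finite \<times> 'w::finite) set \<Rightarrow> (('v set \<times> 'v list) + 'v) pmf" where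
  "queue_mark lam d E = do {
     arrival \<leftarrow> bernoulli_pmf (lam / (lam + 1));
     if arrival then do {
       w \<leftarrow> pmf_of_set UNIV;
       s \<leftarrow> replicate_pmf d (pmf_of_set (server_nbrs E w));
       l \<leftarrow> pmf_of_set (permutations_of_set UNIV);
       return_pmf (Inl (set s, l))
     } else map_pmf Inr (pmf_of_set UNIV)
   }"

lemma argmin_nonempty:
  fixes x :: "'v \<Rightarrow> nat"
  assumes "finite S" "S \<noteq> {}"
  shows "{v \<in> S. \<forall>u\<in>S. x v \<le> x u} \<noteq> {}"
proof -
  have "Min (x ` S) \<in> x ` S" using assms by simp
  then obtain v where "v \<in> S" "x v = Min (x ` S)" by auto
  then show ?thesis using assms by auto
qed

text \<open>
  The priority list realizes the uniform choice in \<open>joined_server\<close> among the shortest sampled queues.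
  The assumption on \<open>d\<close> makes the sample nonempty.
\<close>
lemma queue_step_arrival:
  assumes "0 < d"
  shows "do {
       s \<leftarrow> replicate_pmf d (pmf_of_set (server_nbrs E w));
       l \<leftarrow> pmf_of_set (permutations_of_set UNIV);
       return_pmf (queue_step (Inl (set s, l)) x)
     } = map_pmf (\<lambda>v. x(v := x v + 1)) (joined_server E d w x)"
proof -
  have "bind_pmf (pmf_of_set (permutations_of_set UNIV)) (\<lambda>l. return_pmf (queue_step (Inl (set s, l)) x)) =
      map_pmf (\<lambda>v. x(v := x v + 1)) (pmf_of_set {v \<in> set s. \<forall>u\<in>set s. x v \<le> x u})"
    if "s \<noteq> []" for s :: "'a list"
  proof -
    let ?A = "{v \<in> set s. \<forall>u\<in>set s. x v \<le> x u}"
    let ?f = "\<lambda>r. case r of None \<Rightarrow> x | Some v \<Rightarrow> x(v := x v + 1)"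
    have "bind_pmf (pmf_of_set (permutations_of_set UNIV)) (\<lambda>l. return_pmf (queue_step (Inl (set s, l)) x)) =
        map_pmf ?f (map_pmf (List.find (\<lambda>v. v \<in> ?A)) (pmf_of_set (permutations_of_set UNIV)))"
      by (simp add: map_pmf_def bind_assoc_pmf bind_return_pmf)
    also have "\<dots> = map_pmf ?f (map_pmf Some (pmf_of_set ?A))"
      using argmin_nonempty[of "set s" x] that by (subst find_random_permutation) simp_all
    finally show ?thesis by (simp add: pmf.map_comp o_def)
  qed
  moreover have "s \<noteq> []" if "s \<in> set_pmf (replicate_pmf d (pmf_of_set (server_nbrs E w)))" for s
    using that assms by (auto simp: set_replicate_pmf)
  ultimately show ?thesis
    unfolding joined_server_def map_bind_pmf by (intro bind_pmf_cong refl) simp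
qed

lemma pmf_bind_uniform:
  "pmf (bind_pmf (pmf_of_set (UNIV :: 'c::finite set)) f) y = (\<Sum>a\<in>UNIV. pmf (f a) y) / real CARD('c)"
  by (simp add: pmf_bind integral_pmf_of_set)

lemma queue_rate_uniformization:
  fixes E :: "('v::finite \<times> 'w::finite) set"
  assumes lam: "0 < lam" and d: "0 < d"
  shows "queue_rate lam d E x y = (lam + 1) * real CARD('v) *
    (pmf (map_pmf (\<lambda>m. queue_step m x) (queue_mark lam d E)) y - of_bool (y = x))"
proof -
  let ?N = "real CARD('v)" and ?M = "real CARD('w)"
  let ?J = "\<lambda>w. \<Sum>v\<in>UNIV. pmf (joined_server E d w x) v * of_bool (y = x(v := x v + 1))"
  have J: "pmf (map_pmf (\<lambda>v. x(v := x v + 1)) (joined_server E d w x)) y = ?J w" for w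
    unfolding map_pmf_def pmf_bind
    by (subst integral_measure_pmf_real[where A=UNIV])
      (auto simp: mult.commute indicator_def intro!: sum.cong)
  have "map_pmf (\<lambda>m. queue_step m x) (queue_mark lam d E) =
     bind_pmf (bernoulli_pmf (lam / (lam + 1))) (\<lambda>arrival. if arrival then
       bind_pmf (pmf_of_set UNIV) (\<lambda>w. map_pmf (\<lambda>v. x(v := x v + 1)) (joined_server E d w x))
       else bind_pmf (pmf_of_set UNIV) (\<lambda>v. return_pmf (x(v := x v - 1))))"
    unfolding queue_mark_def queue_step_arrival[OF d, symmetric]
    by (auto simp: map_bind_pmf map_pmf_def bind_assoc_pmf bind_return_pmf intro!: bind_pmf_cong)
  then have "pmf (map_pmf (\<lambda>m. queue_step m x) (queue_mark lam d E)) y =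
      lam / (lam + 1) * pmf (bind_pmf (pmf_of_set UNIV)
        (\<lambda>w. map_pmf (\<lambda>v. x(v := x v + 1)) (joined_server E d w x))) y +
      (1 - lam / (lam + 1)) * pmf (bind_pmf (pmf_of_set UNIV) (\<lambda>v. return_pmf (x(v := x v - 1)))) y"
    using lam by (simp add: pmf_bind[of "bernoulli_pmf _"])
  moreover have "1 - lam / (lam + 1) = 1 / (lam + 1)" using lam by (simp add: field_simps)
  moreover have "pmf (return_pmf (x(v := x v - 1))) y = of_bool (y = x(v := x v - 1))" for v
    by (auto simp: indicator_def)
  ultimately have pmf: "pmf (map_pmf (\<lambda>m. queue_step m x) (queue_mark lam d E)) y =
      lam / (lam + 1) * ((\<Sum>w\<in>UNIV. ?J w) / ?M) +
      1 / (lam + 1) * ((\<Sum>v\<in>UNIV. of_bool (y = x(v := x v - 1))) / ?N)"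
    by (simp only: pmf_bind_uniform J)
  have sum1: "(\<Sum>v\<in>UNIV. pmf (joined_server E d w x) v) = 1" for w
    by (rule sum_pmf_eq_1) auto
  \<comment> \<open>Service attempts at empty queues leave the state unchanged and cancel against the diagonal.\<close>
  have "(\<Sum>v | x v > 0. of_bool (y = x(v := x v - 1)) - of_bool (y = x)) =
      (\<Sum>v\<in>UNIV. of_bool (y = x(v := x v - 1)) - (of_bool (y = x) :: real))"
    by (rule sum.mono_neutral_left) (auto simp: fun_upd_idem)
  also have "\<dots> = (\<Sum>v\<in>UNIV. of_bool (y = x(v := x v - 1))) - ?N * of_bool (y = x)"
    by (simp add: sum_subtractf)
  finally have dep: "(\<Sum>v | x v > 0. of_bool (y = x(v := x v - 1)) - of_bool (y = x)) =
      (\<Sum>v\<in>UNIV. of_bool (y = x(v := x v - 1))) - ?N * of_bool (y = x)" .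
  have linear: "(\<Sum>v\<in>UNIV. c * p v * (a v - b)) = c * ((\<Sum>v\<in>UNIV. p v * a v) - b * (\<Sum>v\<in>UNIV. p v))"
    for c b :: real and p a :: "'v \<Rightarrow> real"
    by (simp add: sum_distrib_left sum_subtractf right_diff_distrib mult_ac)
  have "(\<Sum>w\<in>UNIV. \<Sum>v\<in>UNIV. lam * ?N / ?M * pmf (joined_server E d w x) v *
        (of_bool (y = x(v := x v + 1)) - of_bool (y = x))) =
      (\<Sum>w\<in>(UNIV :: 'w set). lam * ?N / ?M * (?J w - of_bool (y = x) * (\<Sum>v\<in>UNIV. pmf (joined_server E d w x) v)))"
    by (simp only: linear)
  also have "\<dots> = lam * ?N / ?M * (\<Sum>w\<in>UNIV. ?J w) - lam * ?N * of_bool (y = x)"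
    by (simp add: sum1 sum_subtractf right_diff_distrib sum_distrib_left sum_divide_distrib)
  finally have "queue_rate lam d E x y = lam * ?N / ?M * (\<Sum>w\<in>UNIV. ?J w) - lam * ?N * of_bool (y = x) +
      ((\<Sum>v\<in>UNIV. of_bool (y = x(v := x v - 1))) - ?N * of_bool (y = x))"
    unfolding queue_rate_def dep by simp
  also have "\<dots> = (lam + 1) * ?N *
    (pmf (map_pmf (\<lambda>m. queue_step m x) (queue_mark lam d E)) y - of_bool (y = x))"
    unfolding pmf
  proof -
    have "k * ?N * (lam / k * (S / ?M) + 1 / k * (D / ?N) - b) = lam * ?N / ?M * S + D - k * ?N * b"
      if "k \<noteq> 0" for k S D b :: real
      using that by (simp add: field_simps)
    from this[of "lam + 1"] lam show
      "lam * ?N / ?M * S - lam * ?N * b + (D - ?N * b) =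
        (lam + 1) * ?N * (lam / (lam + 1) * (S / ?M) + 1 / (lam + 1) * (D / ?N) - b)" for S D b :: real
      by (simp add: algebra_simps)
  qed
  finally show ?thesis .
qed

section \<open>The ordered coupling\<close>

theorem proposition3p11:
  fixes lam rho0 :: real and d :: nat
    and E :: "('v::finite \<times> 'w::finite) set"
    and M0 :: "'a measure" and X0 :: "'a \<Rightarrow> 'v \<Rightarrow> nat"
    and Minf :: "'b measure" and Xinf :: "'b \<Rightarrow> 'v \<Rightarrow> nat"
    and \<pi> :: "('v \<Rightarrow> nat) pmf"
  assumes "0 < lam" and "lam < 1"
    and "d \<ge> 2"
    and "\<forall>w. card (server_nbrs E w) \<ge> 1"
    and "rho lam E \<le> rho0" and "rho0 < 1"
    and "stationary_distribution lam d E \<pi>"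
    and "random_vector Minf Xinf"
    and "distr Minf (count_space UNIV) Xinf = measure_pmf \<pi>"
    and "random_vector M0 X0"
    and "stoch_le M0 X0 Minf Xinf"
  shows "\<exists>(M :: (real \<Rightarrow> ('v \<Rightarrow> nat) \<times> ('v \<Rightarrow> nat)) measure) X1 X2.
           prob_space M \<and>
           queue_length_process lam d E M X1 \<and> same_law M (X1 0) M0 X0 \<and>
           queue_length_process lam d E M X2 \<and> same_law M (X2 0) Minf Xinf \<and>
           (AE \<omega> in M. \<forall>t\<ge>0. \<forall>v. X1 t \<omega> v \<le> X2 t \<omega> v)"
proof -
  obtain K :: "(('v \<Rightarrow> nat) \<times> ('v \<Rightarrow> nat)) measure" and X' Y'
    where K: "prob_space K"
      and X'[measurable]: "X' \<in> K \<rightarrow>\<^sub>M count_space UNIV"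
      and Y'[measurable]: "Y' \<in> K \<rightarrow>\<^sub>M count_space UNIV"
      and laws: "same_law K X' M0 X0" "same_law K Y' Minf Xinf"
      and le: "AE \<omega> in K. \<forall>v. X' \<omega> v \<le> Y' \<omega> v"
    using \<open>stoch_le M0 X0 Minf Xinf\<close> unfolding stoch_le_def random_vector_def by blast
  interpret K: prob_space K by fact
  \<comment> \<open>The minimum has the law of \<open>X'\<close>, but lies below \<open>Y'\<close> for every \<open>\<omega>\<close> and not just almost surely.\<close>
  define Z where "Z \<omega> = (\<lambda>v. min (X' \<omega> v) (Y' \<omega> v))" for \<omega>
  have Z[measurable]: "Z \<in> K \<rightarrow>\<^sub>M count_space UNIV"
    unfolding Z_def
    by (rule measurable_compose_countable[where g=X', OF _ X'], rule measurable_compose_countable[where g=Y', OF _ Y']) simp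
  have Z_le: "\<forall>v. Z \<omega> v \<le> Y' \<omega> v" for \<omega> by (simp add: Z_def)
  have "distr K (count_space UNIV) Z = distr K (count_space UNIV) X'"
  proof (rule distr_cong_AE)
    show "AE \<omega> in K. Z \<omega> = X' \<omega>"
      using le by eventually_elim (simp add: Z_def fun_eq_iff)
  qed simp_all
  with laws have laws: "same_law K Z M0 X0" "same_law K Y' Minf Xinf"
    by (simp_all add: same_law_def)
  define L where "L = (lam + 1) * real CARD('v)"
  interpret uniformized_chain L "queue_mark lam d E" queue_step
    by unfold_locales (use \<open>0 < lam\<close> in \<open>simp add: L_def\<close>)
  have rate: "rate = queue_rate lam d E"
    using queue_rate_uniformization[of lam d E] \<open>0 < lam\<close> \<open>d \<ge> 2\<close>
    by (intro ext) (subst rate_def, simp add: L_def)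
  let ?f = "\<lambda>p t. (flow (Z (fst p)) t (snd p), flow (Y' (fst p)) t (snd p))"
  let ?M = "image_measure (K \<Otimes>\<^sub>M \<Omega>) ?f"
  have prob: "prob_space ?M"
    by (intro prob_space_image_measure prob_space_pair K prob_space_axioms)
  have chain: "queue_length_process lam d E ?M (\<lambda>t q. fst (q t))"
    "queue_length_process lam d E ?M (\<lambda>t q. snd (q t))"
    unfolding queue_length_process_def rate[symmetric]
    by (rule markov_chain_image_measure; simp add: markov_chain_flow K cadlag_flow)+
  have init: "same_law ?M (\<lambda>q. g (q 0)) K W"
    if [measurable]: "W \<in> K \<rightarrow>\<^sub>M count_space UNIV" and g: "\<And>p. g (?f p 0) = W (fst p)" for g W
  proof -
    have "distr ?M (count_space UNIV) (\<lambda>q. g (q 0)) = distr (K \<Otimes>\<^sub>M \<Omega>) (count_space UNIV) (\<lambda>p. W (fst p))"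
      by (subst distr_image_measure) (simp_all only: g, simp_all)
    also have "\<dots> = distr (distr (K \<Otimes>\<^sub>M \<Omega>) K fst) (count_space UNIV) W"
      by (subst distr_distr) (simp_all add: o_def)
    finally show ?thesis by (simp add: same_law_def distr_pair_fst)
  qed
  have "AE q in ?M. \<forall>t\<ge>0. \<forall>v. fst (q t) v \<le> snd (q t) v"
  proof (rule AE_image_measure)
    show "\<forall>t\<ge>0. \<forall>v. fst (?f p t) v \<le> snd (?f p t) v" for p
      using flow_preserves[of "\<lambda>x y. \<forall>v. x v \<le> y v", OF queue_step_mono Z_le] by simp
  qed
  moreover have "same_law ?M (\<lambda>q. fst (q 0)) M0 X0" "same_law ?M (\<lambda>q. snd (q 0)) Minf Xinf"
    using init[OF Z, of fst] init[OF Y', of snd] laws by (simp_all add: same_law_def)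
  ultimately show ?thesis using prob chain by blast
qed

end
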